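(* For every $\ell\ge2$ and every $\alpha>\frac{3\ell-4}{3\ell-1}$, the problem $\textsc{Hom}(K_\ell,\alpha)$ can be solved in time $(\ell+1)n^2$, where $n$ is the number of vertices of the input graph. Moreover, for every graph $G$ on $n$ vertices with $\delta(G)>\frac{3\ell-4}{3\ell-1}n$, a homomorphism from $G$ to $K_\ell$, if one exists, is unique up to automorphisms of $K_\ell$.
   Context: A homomorphism from a graph $G$ to $K_\ell$ is a map $\phi:V(G)\to[\ell]$ with $\phi(u)\ne\phi(v)$ for every edge $uv$ (i.e. a proper $\ell$-coloring); uniqueness up to automorphisms of $K_\ell$ means any two such maps differ by a permutation of $[\ell]$. The decision problem $\textsc{Hom}(K_\ell,\alpha)$: given an $n$-vertex graph $G$ with minimum degree $\delta(G)\ge\alpha n$, decide whether there is a homomorphism from $G$ to $K_\ell$. *)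

theory Defs
  imports Complex_Main "HOL-Combinatorics.Permutations" "Graph_Theory.Pair_Digraph"
begin

section \<open>Graphs, minimum degree and homomorphisms to complete graphs\<close>

text \<open>
  A finite simple graph is a \<^locale>\<open>pair_graph\<close>: finite, loop-free, with a symmetric arc relation.
  An edge \<open>uv\<close> is the pair of arcs \<open>(u,v)\<close>, \<open>(v,u)\<close>, so the out-degree is the ordinary degree.
  The minimum degree is unspecified for the graph without vertices.
\<close>

definition min_degree :: "'a pair_pre_digraph \<Rightarrow> nat" where
  "min_degree G = Min (out_degree (with_proj G) ` pverts G)"

definition hom_to_K :: "nat \<Rightarrow> 'a pair_pre_digraph \<Rightarrow> ('a \<Rightarrow> nat) \<Rightarrow> bool" where
  "hom_to_K l G \<phi> \<longleftrightarrow>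
     (\<forall>v\<in>pverts G. \<phi> v \<in> {1..l}) \<and> (\<forall>(u, v)\<in>parcs G. \<phi> u \<noteq> \<phi> v)"

text \<open>
  The automorphisms of the complete graph on \<open>{1..l}\<close> are all permutations of \<open>{1..l}\<close>.
  Homomorphisms are compared on the vertex set only.
\<close>

definition hom_to_K_unique :: "nat \<Rightarrow> 'a pair_pre_digraph \<Rightarrow> bool" where
  "hom_to_K_unique l G \<longleftrightarrow>
     (\<forall>\<phi> \<psi>. hom_to_K l G \<phi> \<longrightarrow> hom_to_K l G \<psi> \<longrightarrow>
        (\<exists>\<pi>. \<pi> permutes {1..l} \<and> (\<forall>v\<in>pverts G. \<psi> v = \<pi> (\<phi> v))))"


section \<open>A unit-cost random access machine\<close>

text \<open>
  The machine has registers and a memory, all holding natural numbers.  \<open>Reg i\<close> is register \<open>i\<close>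
  and \<open>Mem i\<close> is the memory cell whose address is stored in register \<open>i\<close>.  The only arithmetic is
  addition and truncated subtraction; in particular there is no unit-cost multiplication.
\<close>

datatype loc = Reg nat | Mem nat

datatype operand = Imm nat | At loc

datatype test = Eq operand operand | Less operand operand

datatype prog =
    Skip
  | Add loc operand operand
  | Sub loc operand operand
  | Seq prog prog
  | If test prog prog
  | While test prog

type_synonym state = "(nat \<Rightarrow> nat) \<times> (nat \<Rightarrow> nat)"

fun load :: "loc \<Rightarrow> state \<Rightarrow> nat" where
  "load (Reg i) (r, m) = r i"
| "load (Mem i) (r, m) = m (r i)"

fun store :: "loc \<Rightarrow> nat \<Rightarrow> state \<Rightarrow> state" where
  "store (Reg i) x (r, m) = (r(i := x), m)"
| "store (Mem i) x (r, m) = (r, m(r i := x))"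

fun operand_val :: "operand \<Rightarrow> state \<Rightarrow> nat" where
  "operand_val (Imm k) s = k"
| "operand_val (At x) s = load x s"

fun test_val :: "test \<Rightarrow> state \<Rightarrow> bool" where
  "test_val (Eq a b) s \<longleftrightarrow> operand_val a s = operand_val b s"
| "test_val (Less a b) s \<longleftrightarrow> operand_val a s < operand_val b s"

text \<open>
  \<open>exec p s t s'\<close>: started in \<open>s\<close>, the program \<open>p\<close> halts in \<open>s'\<close> after exactly \<open>t\<close> steps, where
  every executed assignment and every evaluated test is one step.
\<close>

inductive exec :: "prog \<Rightarrow> state \<Rightarrow> nat \<Rightarrow> state \<Rightarrow> bool" where
  Skip: "exec Skip s 0 s"
| Add: "exec (Add x a b) s 1 (store x (operand_val a s + operand_val b s) s)"
| Sub: "exec (Sub x a b) s 1 (store x (operand_val a s - operand_val b s) s)"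
| Seq: "exec p s t s' \<Longrightarrow> exec q s' t' s'' \<Longrightarrow> exec (Seq p q) s (t + t') s''"
| IfTrue: "test_val b s \<Longrightarrow> exec p s t s' \<Longrightarrow> exec (If b p q) s (1 + t) s'"
| IfFalse: "\<not> test_val b s \<Longrightarrow> exec q s t s' \<Longrightarrow> exec (If b p q) s (1 + t) s'"
| WhileFalse: "\<not> test_val b s \<Longrightarrow> exec (While b p) s 1 s"
| WhileTrue: "test_val b s \<Longrightarrow> exec p s t s' \<Longrightarrow> exec (While b p) s' t' s''
    \<Longrightarrow> exec (While b p) s (1 + t + t') s''"

inductive_cases SkipE: "exec Skip s t s'"
inductive_cases AddE: "exec (Add x a b) s t s'"
inductive_cases SubE: "exec (Sub x a b) s t s'"
inductive_cases SeqE: "exec (Seq p q) s t s'"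
inductive_cases IfE: "exec (If b p q) s t s'"
inductive_cases WhileE: "exec (While b p) s t s'"

lemma exec_deterministic:
  "exec p s t s' \<Longrightarrow> exec p s u s'' \<Longrightarrow> u = t \<and> s'' = s'"
proof (induction arbitrary: u s'' rule: exec.induct)
  case (Skip s)
  then show ?case by (rule SkipE) simp
next
  case (Add x a b s)
  then show ?case by (rule AddE) simp
next
  case (Sub x a b s)
  then show ?case by (rule SubE) simp
next
  case (Seq p s t s' q t' s2)
  from Seq.prems show ?case
  proof (rule SeqE)
    fix v r w
    assume e: "u = v + w" "exec p s v r" "exec q r w s''"
    from Seq.IH(1)[OF e(2)] have r: "v = t" "r = s'" by simp_all
    from Seq.IH(2)[OF e(3)[unfolded r(2)]] show ?thesis using e(1) r by simp
  qed
next
  case (IfTrue b s p t s' q)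
  from IfTrue.prems show ?case
  proof (rule IfE)
    fix v
    assume e: "u = Suc v" "exec p s v s''"
    from IfTrue.IH[OF e(2)] show ?thesis using e(1) by simp
  next
    assume "\<not> test_val b s"
    with IfTrue.hyps(1) show ?thesis by simp
  qed
next
  case (IfFalse b s q t s' p)
  from IfFalse.prems show ?case
  proof (rule IfE)
    assume "test_val b s"
    with IfFalse.hyps(1) show ?thesis by simp
  next
    fix v
    assume e: "u = Suc v" "exec q s v s''"
    from IfFalse.IH[OF e(2)] show ?thesis using e(1) by simp
  qed
next
  case (WhileFalse b s p)
  from WhileFalse.prems show ?case
    by (rule WhileE) (use WhileFalse.hyps in simp_all)
next
  case (WhileTrue b s p t s' t' s2)
  from WhileTrue.prems show ?case
  proof (rule WhileE)
    assume "\<not> test_val b s"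
    with WhileTrue.hyps(1) show ?thesis by simp
  next
    fix v r w
    assume e: "u = Suc (v + w)" "exec p s v r" "exec (While b p) r w s''"
    from WhileTrue.IH(1)[OF e(2)] have r: "v = t" "r = s'" by simp_all
    from WhileTrue.IH(2)[OF e(3)[unfolded r(2)]] show ?thesis using e(1) r by simp
  qed
qed


section \<open>The problem Hom(\<open>K\<^sub>l\<close>, \<open>\<alpha>\<close>)\<close>

text \<open>
  Input convention: the vertices are \<open>0, \<dots>, n - 1\<close>, register \<open>0\<close> holds \<open>n\<close>, and the memory cells
  \<open>0, \<dots>, n\<^sup>2 - 1\<close> hold the adjacency matrix row by row.  All other cells are \<open>0\<close>.
\<close>

definition input_state :: "nat \<Rightarrow> nat pair_pre_digraph \<Rightarrow> state" where
  "input_state n G =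
     (\<lambda>i. if i = 0 then n else 0,
      \<lambda>k. if k < n\<^sup>2 \<and> (k div n, k mod n) \<in> parcs G then 1 else 0)"

text \<open>
  The degree condition is a promise: nothing is required of the program on other inputs.
  The answer is yes iff register \<open>0\<close> is nonzero when the program halts.
\<close>

definition solves_Hom_K :: "prog \<Rightarrow> nat \<Rightarrow> real \<Rightarrow> (nat \<Rightarrow> nat) \<Rightarrow> bool" where
  "solves_Hom_K p l \<alpha> T \<longleftrightarrow>
     (\<forall>n G. n \<ge> 1 \<longrightarrow> pair_graph G \<longrightarrow> pverts G = {..<n} \<longrightarrow>
        real (min_degree G) \<ge> \<alpha> * real n \<longrightarrow>
        (\<exists>t s. exec p (input_state n G) t s \<and> t \<le> T n \<and>
           (fst s 0 \<noteq> 0 \<longleftrightarrow> (\<exists>\<phi>. hom_to_K l G \<phi>))))"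

definition Hom_K_solvable_in_time :: "nat \<Rightarrow> real \<Rightarrow> (nat \<Rightarrow> nat) \<Rightarrow> bool" where
  "Hom_K_solvable_in_time l \<alpha> T \<longleftrightarrow> (\<exists>p. solves_Hom_K p l \<alpha> T)"

end

theory Submission
  imports Defs
begin

text \<open>
  Fix a clique \<open>x\<^sub>0, \<dots>, x\<^bsub>l-1\<^esub>\<close>; by the degree condition a greedy search finds one.  Let the core
  \<open>W\<^sub>j\<close> consist of the common neighbours of all \<open>x\<^sub>k\<close> with \<open>k \<noteq> j\<close>.  In any colouring \<open>\<phi>\<close> it lies
  in the class of \<open>x\<^sub>j\<close>, and \<open>|W\<^sub>j| \<ge> n - (l - 1) d\<close> where \<open>d = n - \<delta> < 3n / (3l - 1)\<close>.  Since
  \<open>2 (n - (l - 1) d) > d\<close>, no vertex misses two cores, so \<open>\<phi> v = \<phi> x\<^sub>j\<close> iff \<open>v\<close> has no neighbour in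
  \<open>W\<^sub>j\<close>.  This determines \<open>\<phi>\<close> up to a permutation of the colours.

  It also shows that first-fit colouring with \<open>l\<close> colours succeeds iff a colouring exists, provided
  that the clique comes first, then the vertices adjacent to at least \<open>l - 1\<close> clique vertices (which
  include all cores), then the rest.  To place a vertex one scans each colour class up to the first
  neighbour, so besides at most \<open>l\<close> neighbours only non-neighbours are read.  At four steps each this
  takes \<open>4 n d + O(n)\<close> steps, which is below \<open>(l + 1) n\<^sup>2\<close> for large \<open>n\<close>.  The finitely many small \<open>n\<close>
  are handled by decision trees that read the adjacency matrix at two steps per entry.
\<close>

section \<open>Colourings of dense graphs\<close>

text \<open>\<open>dense\<close> says d < 3|V| / (3l - 1), cleared of the denominator and of
  subtraction. As \<open>A\<close> is irreflexive, \<open>d\<close> counts every vertex among its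
  own non-neighbours.\<close>

locale dense_graph =
  fixes V :: "'v set" and A :: "'v \<Rightarrow> 'v \<Rightarrow> bool" and l d :: nat
  assumes finite_V: "finite V"
    and A_sym: "A u v \<Longrightarrow> A v u"
    and A_irrefl: "\<not> A v v"
    and nonadj_le: "v \<in> V \<Longrightarrow> card {w \<in> V. \<not> A v w} \<le> d"
    and dense: "3 * l * d < 3 * card V + d"
begin

definition clique :: "(nat \<Rightarrow> 'v) \<Rightarrow> nat \<Rightarrow> bool" where
  "clique x k \<longleftrightarrow> (\<forall>i<k. x i \<in> V) \<and> (\<forall>i<k. \<forall>j<k. i \<noteq> j \<longrightarrow> A (x i) (x j))"

definition colouring :: "('v \<Rightarrow> nat) \<Rightarrow> bool" where
  "colouring \<phi> \<longleftrightarrow> (\<forall>v\<in>V. \<phi> v \<in> {1..l}) \<and> (\<forall>u\<in>V. \<forall>v\<in>V. A u v \<longrightarrow> \<phi> u \<noteq> \<phi> v)"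

definition core :: "(nat \<Rightarrow> 'v) \<Rightarrow> nat \<Rightarrow> 'v set" where
  "core x j = {w \<in> V. \<forall>k\<in>{..<l} - {j}. A (x k) w}"

lemma colouring_proper: "colouring \<phi> \<Longrightarrow> A u v \<Longrightarrow> u \<in> V \<Longrightarrow> v \<in> V \<Longrightarrow> \<phi> u \<noteq> \<phi> v"
  by (simp add: colouring_def)

section \<open>Common neighbours and the greedy clique\<close>

lemma card_common_nbrs:
  assumes "finite I" "x ` I \<subseteq> V"
  shows "card V \<le> card {w \<in> V. \<forall>i\<in>I. A (x i) w} + card I * d"
proof -
  have "V \<subseteq> {w \<in> V. \<forall>i\<in>I. A (x i) w} \<union> (\<Union>i\<in>I. {w \<in> V. \<not> A (x i) w})" by auto
  then have "card V \<le> card ({w \<in> V. \<forall>i\<in>I. A (x i) w} \<union> (\<Union>i\<in>I. {w \<in> V. \<not> A (x i) w}))"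
    using finite_V assms(1) by (intro card_mono) auto
  also have "\<dots> \<le> card {w \<in> V. \<forall>i\<in>I. A (x i) w} + card (\<Union>i\<in>I. {w \<in> V. \<not> A (x i) w})"
    by (rule card_Un_le)
  also have "card (\<Union>i\<in>I. {w \<in> V. \<not> A (x i) w}) \<le> (\<Sum>i\<in>I. card {w \<in> V. \<not> A (x i) w})"
    by (rule card_UN_le[OF assms(1)])
  also have "\<dots> \<le> (\<Sum>i\<in>I. d)" using assms(2) by (intro sum_mono nonadj_le) auto
  finally show ?thesis by simp
qed

text \<open>At most l - 1 non-neighbourhoods of size \<open>d\<close> cannot cover \<open>V\<close>,
  because \<open>dense\<close> forces (l - 1) d < |V|.\<close>

lemma ex_common_nbr:
  assumes "clique x k" "k < l"
  shows "\<exists>w\<in>V. \<forall>i<k. A (x i) w"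
proof (rule ccontr)
  assume "\<not> ?thesis"
  then have empty: "{w \<in> V. \<forall>i\<in>{..<k}. A (x i) w} = {}" by (simp add: Ball_def)
  then have "card V \<le> k * d"
    using card_common_nbrs[of "{..<k}" x, unfolded empty] assms(1) by (auto simp: clique_def)
  also have "k * d + d \<le> l * d"
    using mult_le_mono1[of "Suc k" l d] assms(2) by simp
  ultimately show False using dense by simp
qed

lemma ex_clique: "k \<le> l \<Longrightarrow> \<exists>x. clique x k"
proof (induction k)
  case 0
  show ?case by (simp add: clique_def)
next
  case (Suc k)
  then obtain x where x: "clique x k" by auto
  with Suc.prems obtain w where "w \<in> V" "\<forall>i<k. A (x i) w"
    using ex_common_nbr[of x k] by auto
  with x have "clique (x(k := w)) (Suc k)"
    by (auto simp: clique_def less_Suc_eq intro: A_sym)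
  then show ?case by blast
qed

text \<open>Adjacency makes the colours distinct, and \<open>l\<close> distinct values exhaust the
  palette.\<close>

lemma clique_colours:
  assumes "clique x l" "colouring \<phi>"
  shows "bij_betw (\<lambda>i. \<phi> (x i)) {..<l} {1..l}"
proof -
  have inj: "inj_on (\<lambda>i. \<phi> (x i)) {..<l}"
    using assms colouring_proper[OF assms(2)] unfolding inj_on_def clique_def by (metis lessThan_iff)
  moreover have "(\<lambda>i. \<phi> (x i)) ` {..<l} \<subseteq> {1..l}"
    using assms by (auto simp: clique_def colouring_def)
  ultimately have "(\<lambda>i. \<phi> (x i)) ` {..<l} = {1..l}"
    by (intro card_seteq) (auto simp: card_image)
  with inj show ?thesis by (simp add: bij_betw_def)
qed

section \<open>Cores and uniqueness of the colouring\<close>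

lemma ex_class:
  assumes "clique x l" "colouring \<phi>" "v \<in> V"
  obtains j where "j < l" "\<phi> v = \<phi> (x j)"
proof -
  have "\<phi> v \<in> (\<lambda>i. \<phi> (x i)) ` {..<l}"
    using clique_colours[OF assms(1,2)] assms(2,3) by (simp add: bij_betw_def colouring_def)
  then show ?thesis using that by auto
qed

text \<open>By \<open>ex_class\<close> the colour of \<open>w\<close> is that of some
  \<open>x i\<close>, and adjacency to \<open>x k\<close> excludes every k other than
  \<open>j\<close>.\<close>

lemma core_class:
  assumes "clique x l" "colouring \<phi>" "w \<in> core x j"
  shows "\<phi> w = \<phi> (x j)"
proof -
  from assms(3) have w: "w \<in> V" "\<And>k. k < l \<Longrightarrow> k \<noteq> j \<Longrightarrow> A (x k) w" by (auto simp: core_def)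
  from ex_class[OF assms(1,2) w(1)] obtain i where i: "i < l" "\<phi> w = \<phi> (x i)" .
  with w assms(1,2) have "i = j" by (metis clique_def colouring_def)
  with i show ?thesis by simp
qed

lemma card_core:
  assumes "clique x l" "j < l"
  shows "card V + d \<le> card (core x j) + l * d"
proof -
  have "card V \<le> card (core x j) + card ({..<l} - {j}) * d"
    unfolding core_def using assms by (intro card_common_nbrs) (auto simp: clique_def)
  moreover have "card ({..<l} - {j}) + 1 = l" using assms by (simp add: card_Diff_singleton)
  then have "card ({..<l} - {j}) * d + d = l * d" by (metis add_mult_distrib mult_1)
  ultimately show ?thesis by linarith
qed

text \<open>Two cores are too large to lie together in one non-neighbourhood.\<close>

lemma nbr_in_core:
  assumes "clique x l" "colouring \<phi>" "v \<in> V" "j < l" "\<phi> v \<noteq> \<phi> (x j)"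
  shows "\<exists>w\<in>core x j. A v w"
proof (rule ccontr)
  assume no: "\<not> ?thesis"
  from ex_class[OF assms(1-3)] obtain i where i: "i < l" "\<phi> v = \<phi> (x i)" .
  have disj: "core x i \<inter> core x j = {}"
    using core_class[OF assms(1,2), of _ i] core_class[OF assms(1,2), of _ j] i assms(5) by fastforce
  have fin: "finite (core x k)" for k using finite_V by (simp add: core_def)
  \<comment> \<open>The vertex lies in class \<open>i\<close> and core \<open>i\<close> has the same
    colour, so \<open>v\<close> has no neighbour in either core.\<close>
  have "\<not> A v w" if "w \<in> core x i" for w
    using colouring_proper[OF assms(2) _ assms(3), of w] core_class[OF assms(1,2) that] that i
    by (auto simp: core_def)
  with no have "core x i \<union> core x j \<subseteq> {w \<in> V. \<not> A v w}" by (auto simp: core_def)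
  then have "card (core x i \<union> core x j) \<le> d"
    using finite_V by (intro le_trans[OF card_mono nonadj_le[OF assms(3)]]) auto
  then have "card (core x i) + card (core x j) \<le> d" using disj fin by (simp add: card_Un_disjoint)
  \<comment> \<open>The size bounds add up to 2|V| + d \<le> 2ld, whereas \<open>dense\<close> gives
    2ld < 2|V| + 2d/3.\<close>
  with card_core[OF assms(1) i(1)] card_core[OF assms(1,4)] dense show False by linarith
qed

text \<open>The right-hand side depends on the graph and the clique only, so every colouring has the
  same classes.\<close>

lemma class_eq_iff:
  assumes "clique x l" "colouring \<phi>" "v \<in> V" "j < l"
  shows "\<phi> v = \<phi> (x j) \<longleftrightarrow> (\<forall>w\<in>core x j. \<not> A v w)"
proof
  assume eq: "\<phi> v = \<phi> (x j)"
  show "\<forall>w\<in>core x j. \<not> A v w"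
  proof
    fix w assume w: "w \<in> core x j"
    then show "\<not> A v w"
      using colouring_proper[OF assms(2) _ assms(3), of w] core_class[OF assms(1,2) w] eq w
      by (auto simp: core_def)
  qed
qed (use nbr_in_core[OF assms] in blast)

theorem colouring_unique:
  assumes "colouring \<phi>" "colouring \<psi>"
  shows "\<exists>\<pi>. \<pi> permutes {1..l} \<and> (\<forall>v\<in>V. \<psi> v = \<pi> (\<phi> v))"
proof -
  obtain x where x: "clique x l" using ex_clique by blast
  define f where "f = inv_into {..<l} (\<lambda>i. \<phi> (x i))"
  have b: "bij_betw (\<lambda>i. \<phi> (x i)) {..<l} {1..l}" "bij_betw (\<lambda>i. \<psi> (x i)) {..<l} {1..l}"
    using clique_colours x assms by auto
  have "bij_betw ((\<lambda>i. \<psi> (x i)) \<circ> f) {1..l} {1..l}"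
    unfolding f_def by (rule bij_betw_trans[OF bij_betw_inv_into[OF b(1)] b(2)])
  then have "bij_betw (\<lambda>c. \<psi> (x (f c))) {1..l} {1..l}" by (simp add: o_def)
  \<comment> \<open>\<pi> carries the colour of \<open>x j\<close> under \<phi> to its colour under
    \<psi>; \<open>permutes\<close> requires the identity outside {1..l}.\<close>
  moreover define \<pi> where "\<pi> c = (if c \<in> {1..l} then \<psi> (x (f c)) else c)" for c
  moreover have "bij_betw \<pi> {1..l} {1..l} = bij_betw (\<lambda>c. \<psi> (x (f c))) {1..l} {1..l}"
    by (rule bij_betw_cong) (simp add: \<pi>_def)
  ultimately have "bij_betw \<pi> {1..l} {1..l}" by simp
  then have "\<pi> permutes {1..l}" by (rule bij_imp_permutes) (auto simp: \<pi>_def)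
  moreover have "\<psi> v = \<pi> (\<phi> v)" if v: "v \<in> V" for v
  proof -
    from ex_class[OF x assms(1) v] obtain j where j: "j < l" "\<phi> v = \<phi> (x j)" .
    then have "f (\<phi> v) = j" using bij_betw_inv_into_left[OF b(1), of j] by (simp add: f_def)
    moreover have "\<psi> v = \<psi> (x j)"
      using class_eq_iff[OF x assms(1) v j(1)] class_eq_iff[OF x assms(2) v j(1)] j(2) by simp
    ultimately show ?thesis using assms(1) v by (simp add: \<pi>_def colouring_def)
  qed
  ultimately show ?thesis by blast
qed

end

section \<open>First-fit colouring\<close>

text \<open>The flag records that some vertex could not be placed.\<close>

fun place :: "('v \<Rightarrow> 'v \<Rightarrow> bool) \<Rightarrow> 'v \<Rightarrow> nat \<Rightarrow> nat \<Rightarrow> (nat \<Rightarrow> 'v list) \<times> bool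
    \<Rightarrow> (nat \<Rightarrow> 'v list) \<times> bool" where
  "place A v 0 i (L, b) = (L, True)"
| "place A v (Suc m) i (L, b) =
     (if \<exists>w\<in>set (L i). A v w then place A v m (Suc i) (L, b) else (L(i := L i @ [v]), b))"

definition first_fit :: "('v \<Rightarrow> 'v \<Rightarrow> bool) \<Rightarrow> nat \<Rightarrow> 'v list \<Rightarrow> (nat \<Rightarrow> 'v list) \<times> bool" where
  "first_fit A l vs = fold (\<lambda>v. place A v l 0) vs (\<lambda>_. [], False)"

lemma first_fit_Nil [simp]: "first_fit A l [] = (\<lambda>_. [], False)"
  by (simp add: first_fit_def)

lemma first_fit_snoc [simp]: "first_fit A l (vs @ [v]) = place A v l 0 (first_fit A l vs)"
  by (simp add: first_fit_def)

text \<open>Serves the invariants that hold wherever the vertex lands. Where the exact list matters,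
  \<open>place_eq\<close> is used.\<close>

lemma place_cases:
  obtains (placed) j where "i \<le> j" "j < i + m" "\<forall>w\<in>set (L j). \<not> A v w"
      "place A v m i (L, b) = (L(j := L j @ [v]), b)"
  | (failed) "place A v m i (L, b) = (L, True)"
proof (induction m arbitrary: i thesis)
  case 0
  then show ?case by simp
next
  case (Suc m)
  show ?case
  proof (cases "\<exists>w\<in>set (L i). A v w")
    case True
    show ?thesis
    proof (rule Suc.IH[of "Suc i"])
      fix j assume "Suc i \<le> j" "j < Suc i + m" "\<forall>w\<in>set (L j). \<not> A v w"
        "place A v m (Suc i) (L, b) = (L(j := L j @ [v]), b)"
      then show ?thesis using True by (intro Suc.prems(1)[of j]) (simp_all add: fun_upd_def)
    next
      assume "place A v m (Suc i) (L, b) = (L, True)"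
      then show ?thesis using True by (intro Suc.prems(2)) simp
    qed
  next
    case False
    then show ?thesis by (intro Suc.prems(1)[of i]) (simp_all add: fun_upd_def)
  qed
qed

lemma place_eq:
  assumes "i \<le> j" "j < i + m" "\<And>k. i \<le> k \<Longrightarrow> k < j \<Longrightarrow> \<exists>w\<in>set (L k). A v w"
    "\<forall>w\<in>set (L j). \<not> A v w"
  shows "place A v m i (L, b) = (L(j := L j @ [v]), b)"
  using assms
proof (induction m arbitrary: i)
  case 0
  then show ?case by simp
next
  case (Suc m)
  show ?case
  proof (cases "i = j")
    case True
    with Suc.prems show ?thesis by (simp add: fun_upd_def)
  next
    case False
    with Suc.prems have "\<exists>w\<in>set (L i). A v w" by simp
    moreover have "place A v m (Suc i) (L, b) = (L(j := L j @ [v]), b)"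
      using Suc.prems False by (intro Suc.IH) auto
    ultimately show ?thesis by (simp add: fun_upd_def)
  qed
qed

text \<open>A vertex joins only a list without its neighbours; symmetry and irreflexivity cover the
  new pairs. The flag is never reset, so a false flag at the end means that every vertex was
  placed.\<close>

lemma first_fit_sound:
  assumes "\<And>u v. A u v \<Longrightarrow> A v u" "\<And>v. \<not> A v v" "first_fit A l vs = (L, b)"
  shows "(\<forall>i<l. \<forall>u\<in>set (L i). \<forall>w\<in>set (L i). \<not> A u w) \<and>
    (\<not> b \<longrightarrow> set vs \<subseteq> (\<Union>i<l. set (L i)))"
  using assms(3)
proof (induction vs arbitrary: L b rule: rev_induct)
  case Nil
  then show ?case by auto
next
  case (snoc v vs)
  obtain L0 b0 where L0: "first_fit A l vs = (L0, b0)" by fastforce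
  note IH = snoc.IH[OF L0]
  show ?case
  proof (rule place_cases[of 0 l L0 A v b0])
    fix j assume j: "j < 0 + l" "\<forall>w\<in>set (L0 j). \<not> A v w"
      "place A v l 0 (L0, b0) = (L0(j := L0 j @ [v]), b0)"
    then have L: "L = L0(j := L0 j @ [v])" "b = b0" using snoc.prems L0 by auto
    show ?thesis
    proof (intro conjI impI allI ballI subsetI)
      fix i u w assume "i < l" "u \<in> set (L i)" "w \<in> set (L i)"
      then show "\<not> A u w" using IH j(2) assms(1,2) by (auto simp: L split: if_splits)
    next
      fix u assume "\<not> b" "u \<in> set (vs @ [v])"
      then show "u \<in> (\<Union>i<l. set (L i))" using IH j(1) by (auto simp: L split: if_splits)
    qed
  next
    assume "place A v l 0 (L0, b0) = (L0, True)"
    then show ?thesis using snoc.prems L0 IH by auto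
  qed
qed

text \<open>With \<open>P\<close> the non-neighbours of the next vertex, this bounds the time of placing it.\<close>

lemma first_fit_filter_le:
  assumes "first_fit A l vs = (L, b)"
  shows "(\<Sum>i<l. length (filter P (L i))) \<le> length (filter P vs)"
  using assms
proof (induction vs arbitrary: L b rule: rev_induct)
  case Nil
  then show ?case by auto
next
  case (snoc v vs)
  obtain L0 b0 where L0: "first_fit A l vs = (L0, b0)" by fastforce
  note IH = snoc.IH[OF L0]
  show ?case
  proof (rule place_cases[of 0 l L0 A v b0])
    fix j assume j: "j < 0 + l" "place A v l 0 (L0, b0) = (L0(j := L0 j @ [v]), b0)"
    then have L: "L = L0(j := L0 j @ [v])" using snoc.prems L0 by auto
    have "(\<Sum>i<l. length (filter P (L i))) =
        length (filter P (L j)) + (\<Sum>i\<in>{..<l} - {j}. length (filter P (L i)))"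
      using j by (intro sum.remove) auto
    also have "(\<Sum>i\<in>{..<l} - {j}. length (filter P (L i))) =
        (\<Sum>i\<in>{..<l} - {j}. length (filter P (L0 i)))"
      by (intro sum.cong) (auto simp: L)
    also have "length (filter P (L j)) = length (filter P (L0 j)) + length (filter P [v])"
      by (simp add: L)
    also have "length (filter P (L0 j)) + length (filter P [v]) +
        (\<Sum>i\<in>{..<l} - {j}. length (filter P (L0 i))) =
        (\<Sum>i<l. length (filter P (L0 i))) + length (filter P [v])"
      using j by (subst sum.remove[of "{..<l}" j]) auto
    finally show ?thesis using IH by simp
  next
    assume "place A v l 0 (L0, b0) = (L0, True)"
    then show ?thesis using snoc.prems L0 IH by auto
  qed
qed

section \<open>Completeness of first fit when the clique comes first\<close>

context dense_graph
begin

text \<open>In a colourable graph no vertex is adjacent to all of the clique, so l - 1 is the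
  largest possible count: a good vertex is adjacent to the clique vertices of all classes but its
  own.\<close>

definition good :: "(nat \<Rightarrow> 'v) \<Rightarrow> 'v \<Rightarrow> bool" where
  "good x v \<longleftrightarrow> l - 1 \<le> card {i. i < l \<and> A (x i) v}"

text \<open>The invariant for completeness: first fit has not failed and reproduces \<phi> so far,
  the clique naming the lists.\<close>

definition consistent :: "('v \<Rightarrow> nat) \<Rightarrow> (nat \<Rightarrow> 'v) \<Rightarrow> (nat \<Rightarrow> 'v list) \<times> bool \<Rightarrow> bool" where
  "consistent \<phi> x = (\<lambda>(L, b). \<not> b \<and> (\<forall>i<l. \<forall>w\<in>set (L i). w \<in> V \<and> \<phi> w = \<phi> (x i)))"

text \<open>List \<open>j\<close> holds only vertices coloured like \<open>v\<close>, hence no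
  neighbour of \<open>v\<close>; the last hypothesis blocks the earlier lists.\<close>

lemma place_consistent:
  assumes "colouring \<phi>" "consistent \<phi> x (L, b)" "v \<in> V" "j < l" "\<phi> v = \<phi> (x j)"
    "\<And>i. i < j \<Longrightarrow> \<exists>w\<in>set (L i). A v w"
  shows "place A v l 0 (L, b) = (L(j := L j @ [v]), b) \<and>
    consistent \<phi> x (L(j := L j @ [v]), b)"
proof
  have "\<forall>w\<in>set (L j). \<not> A v w"
    using assms(1-5) by (fastforce simp: consistent_def colouring_def)
  then show "place A v l 0 (L, b) = (L(j := L j @ [v]), b)"
    using assms(4,6) by (intro place_eq) auto
  show "consistent \<phi> x (L(j := L j @ [v]), b)"
    using assms(2,3,5) by (auto simp: consistent_def)
qed

lemma first_fit_clique:
  assumes "clique x l" "colouring \<phi>" "k \<le> l"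
  shows "\<exists>L b. first_fit A l (map x [0..<k]) = (L, b) \<and> consistent \<phi> x (L, b) \<and>
    (\<forall>i<k. x i \<in> set (L i))"
  using assms(3)
proof (induction k)
  case 0
  show ?case by (auto simp: consistent_def)
next
  case (Suc k)
  then obtain L b where L: "first_fit A l (map x [0..<k]) = (L, b)" "consistent \<phi> x (L, b)"
    "\<forall>i<k. x i \<in> set (L i)" by auto
  have "place A (x k) l 0 (L, b) = (L(k := L k @ [x k]), b) \<and>
    consistent \<phi> x (L(k := L k @ [x k]), b)"
  proof (rule place_consistent[OF assms(2) L(2)])
    show "\<exists>w\<in>set (L i). A (x k) w" if "i < k" for i
      using that L(3) assms(1) Suc.prems by (auto simp: clique_def intro!: bexI[of _ "x i"])
  qed (use assms(1) Suc.prems in \<open>auto simp: clique_def\<close>)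
  then show ?case using L(1,3) by (auto simp: less_Suc_eq)
qed

text \<open>Lists only grow, so a neighbour present in every foreign list at the start still blocks
  that list when the turn of \<open>v\<close> comes. The final conclusion locates the new vertices
  for the next segment of the order.\<close>

lemma first_fit_extend:
  assumes "clique x l" "colouring \<phi>"
    "first_fit A l us = (L, b)" "consistent \<phi> x (L, b)" "set vs \<subseteq> V"
    "\<And>v i. v \<in> set vs \<Longrightarrow> i < l \<Longrightarrow> \<phi> v \<noteq> \<phi> (x i) \<Longrightarrow> \<exists>w\<in>set (L i). A v w"
  shows "\<exists>L' b'. first_fit A l (us @ vs) = (L', b') \<and> consistent \<phi> x (L', b') \<and>
    (\<forall>i<l. set (L i) \<subseteq> set (L' i)) \<and> (\<forall>v\<in>set vs. \<forall>i<l. \<phi> v = \<phi> (x i) \<longrightarrow> v \<in> set (L' i))"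
  using assms(5,6)
proof (induction vs rule: rev_induct)
  case Nil
  then show ?case using assms(3,4) by simp
next
  case (snoc v vs)
  from snoc.IH snoc.prems obtain L' b' where L': "first_fit A l (us @ vs) = (L', b')"
    "consistent \<phi> x (L', b')" "\<forall>i<l. set (L i) \<subseteq> set (L' i)"
    "\<forall>v\<in>set vs. \<forall>i<l. \<phi> v = \<phi> (x i) \<longrightarrow> v \<in> set (L' i)" by auto
  have v: "v \<in> V" using snoc.prems by simp
  from ex_class[OF assms(1,2) v] obtain j where j: "j < l" "\<phi> v = \<phi> (x j)" .
  have inj: "i = j" if "i < l" "\<phi> v = \<phi> (x i)" for i
    using clique_colours[OF assms(1,2)] that j by (auto simp: bij_betw_def inj_on_def)
  have "place A v l 0 (L', b') = (L'(j := L' j @ [v]), b') \<and>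
    consistent \<phi> x (L'(j := L' j @ [v]), b')"
  proof (rule place_consistent[OF assms(2) L'(2) v j])
    fix i assume i: "i < j"
    then have "\<phi> v \<noteq> \<phi> (x i)" "i < l" using inj[of i] j(1) by auto
    then have "\<exists>w\<in>set (L i). A v w" by (intro snoc.prems(2)) auto
    then show "\<exists>w\<in>set (L' i). A v w" using L'(3) \<open>i < l\<close> by blast
  qed
  moreover have "first_fit A l (us @ vs @ [v]) = place A v l 0 (L', b')"
    using L'(1) first_fit_snoc[of A l "us @ vs" v] by simp
  moreover have "set (L i) \<subseteq> set ((L'(j := L' j @ [v])) i)" if "i < l" for i
    using L'(3) that by auto
  moreover have "u \<in> set ((L'(j := L' j @ [v])) i)"
    if "u \<in> set (vs @ [v])" "i < l" "\<phi> u = \<phi> (x i)" for u i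
    using L'(4) inj that by auto
  ultimately show ?case by metis
qed

text \<open>When \<open>vs\<close> enumerates \<open>V\<close>, the clique vertices occur a second
  time. This spares the passes a membership test and costs at most \<open>l\<close> extra list
  entries.\<close>

definition clique_first :: "(nat \<Rightarrow> 'v) \<Rightarrow> 'v list \<Rightarrow> 'v list" where
  "clique_first x vs = map x [0..<l] @ filter (good x) vs @ filter (\<lambda>v. \<not> good x v) vs"

lemma first_fit_complete:
  assumes "clique x l" "colouring \<phi>" "set vs = V"
  shows "\<not> snd (first_fit A l (clique_first x vs))"
proof -
  let ?g = "filter (good x) vs" and ?h = "filter (\<lambda>v. \<not> good x v) vs"
  from first_fit_clique[OF assms(1,2) order.refl] obtain L b
    where L: "first_fit A l (map x [0..<l]) = (L, b)" "consistent \<phi> x (L, b)"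
      "\<forall>i<l. x i \<in> set (L i)" by blast
  have "\<exists>w\<in>set (L i). A v w"
    if v: "v \<in> set ?g" and i: "i < l" "\<phi> v \<noteq> \<phi> (x i)" for v i
  proof -
    have vV: "v \<in> V" using v assms(3) by auto
    from ex_class[OF assms(1,2) vV] obtain j where j: "j < l" "\<phi> v = \<phi> (x j)" .
    then have "\<not> A (x j) v"
      using colouring_proper[OF assms(2), of "x j" v] assms(1) vV by (auto simp: clique_def)
    then have "{i. i < l \<and> A (x i) v} \<subseteq> {..<l} - {j}" by auto
    moreover have "card ({..<l} - {j}) \<le> card {i. i < l \<and> A (x i) v}"
      using v j(1) by (simp add: good_def)
    \<comment> \<open>At least l - 1 clique neighbours, none of them \<open>x j\<close>, must be all
      the others.\<close>
    ultimately have "{i. i < l \<and> A (x i) v} = {..<l} - {j}" by (intro card_seteq) auto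
    moreover have "i \<noteq> j" using i j by auto
    ultimately have "A (x i) v" using i by blast
    then show ?thesis using L(3) i A_sym by blast
  qed
  then obtain L' b' where L': "first_fit A l (map x [0..<l] @ ?g) = (L', b')"
    "consistent \<phi> x (L', b')" "\<forall>v\<in>set ?g. \<forall>i<l. \<phi> v = \<phi> (x i) \<longrightarrow> v \<in> set (L' i)"
    using first_fit_extend[OF assms(1,2) L(1,2), of ?g] assms(3) by auto
  \<comment> \<open>Core vertices are good, so after the second segment list \<open>i\<close>
    contains the whole core; \<open>nbr_in_core\<close> then blocks the foreign lists for the
    remaining vertices.\<close>
  have core: "core x i \<subseteq> set (L' i)" if i: "i < l" for i
  proof
    fix w assume w: "w \<in> core x i"
    then have "card ({..<l} - {i}) \<le> card {i. i < l \<and> A (x i) w}"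
      by (intro card_mono) (auto simp: core_def)
    then have "good x w" using i by (simp add: good_def)
    with w assms(3) have "w \<in> set ?g" by (auto simp: core_def)
    then show "w \<in> set (L' i)" using L'(3) i core_class[OF assms(1,2) w] by auto
  qed
  have "\<exists>w\<in>set (L' i). A v w"
    if v: "v \<in> set ?h" and i: "i < l" "\<phi> v \<noteq> \<phi> (x i)" for v i
    using nbr_in_core[OF assms(1,2) _ i] v assms(3) core[OF i(1)] by auto
  then obtain L'' b'' where "first_fit A l ((map x [0..<l] @ ?g) @ ?h) = (L'', b'')"
    "consistent \<phi> x (L'', b'')"
    using first_fit_extend[OF assms(1,2) L'(1,2), of ?h] assms(3) by auto
  then show ?thesis by (simp add: consistent_def clique_first_def)
qed

theorem first_fit_correct:
  assumes "clique x l" "set vs = V"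
  shows "snd (first_fit A l (clique_first x vs)) \<longleftrightarrow> \<not> (\<exists>\<phi>. colouring \<phi>)"
proof -
  obtain L b where L: "first_fit A l (clique_first x vs) = (L, b)" by fastforce
  have "\<exists>\<phi>. colouring \<phi>" if "\<not> b"
  proof -
    note sound = first_fit_sound[OF A_sym A_irrefl L]
    have "V \<subseteq> set (clique_first x vs)" using assms(2) by (auto simp: clique_first_def)
    with sound that have "\<forall>v\<in>V. \<exists>i<l. v \<in> set (L i)" by blast
    then obtain c where c: "\<And>v. v \<in> V \<Longrightarrow> c v < l \<and> v \<in> set (L (c v))" by metis
    \<comment> \<open>Lists are numbered from 0, colours from 1.\<close>
    have "colouring (\<lambda>v. Suc (c v))"
      unfolding colouring_def
    proof (intro conjI ballI impI)
      fix u v assume uv: "u \<in> V" "v \<in> V" "A u v"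
      show "Suc (c u) \<noteq> Suc (c v)"
      proof
        assume "Suc (c u) = Suc (c v)"
        then have "u \<in> set (L (c v))" using c[OF uv(1)] by simp
        with sound c[OF uv(2)] uv(3) show False by blast
      qed
    qed (use c in \<open>simp add: Suc_le_eq\<close>)
    then show ?thesis by blast
  qed
  then show ?thesis using first_fit_complete[OF assms(1) _ assms(2)] L by auto
qed

text \<open>Each non-neighbour occurs at most once in \<open>vs\<close>, which gives
  \<open>d\<close>; the clique segment \<open>us\<close> may repeat vertices of \<open>vs\<close>
  and adds at most \<open>l\<close>.\<close>

lemma nonadj_entries_le:
  assumes "first_fit A l (us @ vs) = (L, b)" "length us \<le> l" "distinct vs" "set vs \<subseteq> V" "v \<in> V"
  shows "(\<Sum>i<l. length (filter (\<lambda>w. \<not> A v w) (L i))) \<le> l + d"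
proof -
  have "length (filter (\<lambda>w. \<not> A v w) vs) = card (set (filter (\<lambda>w. \<not> A v w) vs))"
    using assms(3) by (intro distinct_card[symmetric]) simp
  also have "\<dots> \<le> card {w \<in> V. \<not> A v w}" using assms(4) finite_V by (intro card_mono) auto
  also have "\<dots> \<le> d" by (rule nonadj_le[OF assms(5)])
  finally have "length (filter (\<lambda>w. \<not> A v w) vs) \<le> d" .
  moreover have "length (filter (\<lambda>w. \<not> A v w) us) \<le> l"
    using assms(2) length_filter_le le_trans by blast
  ultimately show ?thesis
    using first_fit_filter_le[OF assms(1), of "\<lambda>w. \<not> A v w"] by simp
qed

end

section \<open>Time-bounded correctness of programs\<close>

text \<open>A total-correctness judgement; a time bound in place of the exact count permits
  weakening.\<close>

definition runs :: "prog \<Rightarrow> state \<Rightarrow> nat \<Rightarrow> (state \<Rightarrow> bool) \<Rightarrow> bool" where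
  "runs p s T Q \<longleftrightarrow> (\<exists>t s'. exec p s t s' \<and> t \<le> T \<and> Q s')"

lemma runsI: "exec p s t s' \<Longrightarrow> t \<le> T \<Longrightarrow> Q s' \<Longrightarrow> runs p s T Q"
  unfolding runs_def by blast

lemma runs_mono:
  "runs p s T Q \<Longrightarrow> T \<le> T' \<Longrightarrow> (\<And>s'. Q s' \<Longrightarrow> Q' s') \<Longrightarrow> runs p s T' Q'"
  unfolding runs_def using le_trans by blast

lemma runs_Skip [simp]: "runs Skip s T Q \<longleftrightarrow> Q s"
proof
  show "Q s \<Longrightarrow> runs Skip s T Q" by (rule runsI[OF exec.Skip]) auto
qed (auto simp: runs_def elim: SkipE)

text \<open>Stated as an equivalence so that the simplifier can execute straight-line code
  symbolically.\<close>

lemma runs_Add [simp]: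
  "runs (Add x a b) s T Q \<longleftrightarrow> 0 < T \<and> Q (store x (operand_val a s + operand_val b s) s)"
proof -
  have "1 \<le> T \<longleftrightarrow> 0 < T" by auto
  then show ?thesis unfolding runs_def by (metis AddE One_nat_def exec.Add)
qed

lemma runs_Seq:
  assumes "runs p s T1 (\<lambda>s'. runs q s' T2 Q)" "T1 + T2 \<le> T"
  shows "runs (Seq p q) s T Q"
proof -
  from assms(1) obtain t s' t' s'' where "exec p s t s'" "t \<le> T1" "exec q s' t' s''" "t' \<le> T2" "Q s''"
    unfolding runs_def by blast
  with assms(2) show ?thesis by (intro runsI[OF exec.Seq[of p s t s' q t' s'']]) auto
qed

lemma runs_Seq_Add [simp]:
  "runs (Seq (Add x a b) q) s T Q \<longleftrightarrow>
     0 < T \<and> runs q (store x (operand_val a s + operand_val b s) s) (T - 1) Q"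
proof
  assume "runs (Seq (Add x a b) q) s T Q"
  then obtain t s' where t: "exec (Seq (Add x a b) q) s t s'" "t \<le> T" "Q s'"
    unfolding runs_def by blast
  from t(1) show "0 < T \<and> runs q (store x (operand_val a s + operand_val b s) s) (T - 1) Q"
  proof (rule SeqE)
    fix t1 s1 t2 assume e: "t = t1 + t2" "exec (Add x a b) s t1 s1" "exec q s1 t2 s'"
    from e(2) have "t1 = 1" "s1 = store x (operand_val a s + operand_val b s) s"
      by (auto elim: AddE)
    with e t show ?thesis by (auto intro: runsI)
  qed
next
  assume "0 < T \<and> runs q (store x (operand_val a s + operand_val b s) s) (T - 1) Q"
  then show "runs (Seq (Add x a b) q) s T Q" by (intro runs_Seq[of _ _ 1 _ "T - 1"]) auto
qed

lemma runs_If [simp]: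
  "runs (If c p q) s T Q \<longleftrightarrow>
     0 < T \<and> (if test_val c s then runs p s (T - 1) Q else runs q s (T - 1) Q)"
proof
  assume "runs (If c p q) s T Q"
  then obtain t s' where t: "exec (If c p q) s t s'" "t \<le> T" "Q s'"
    unfolding runs_def by blast
  from t(1) show "0 < T \<and> (if test_val c s then runs p s (T - 1) Q else runs q s (T - 1) Q)"
    by (rule IfE) (use t(2,3) in \<open>auto intro: runsI\<close>)
next
  assume a: "0 < T \<and> (if test_val c s then runs p s (T - 1) Q else runs q s (T - 1) Q)"
  show "runs (If c p q) s T Q"
  proof (cases "test_val c s")
    case True
    with a obtain t s' where "exec p s t s'" "t \<le> T - 1" "Q s'" unfolding runs_def by metis
    with a True show ?thesis by (intro runsI[OF exec.IfTrue[of c s p t s' q]]) auto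
  next
    case False
    with a obtain t s' where "exec q s t s'" "t \<le> T - 1" "Q s'" unfolding runs_def by metis
    with a False show ?thesis by (intro runsI[OF exec.IfFalse[of c s q t s' p]]) auto
  qed
qed

lemma runs_While_False: "\<not> test_val c s \<Longrightarrow> 0 < T \<Longrightarrow> Q s \<Longrightarrow> runs (While c p) s T Q"
  by (rule runsI[OF exec.WhileFalse]) auto

lemma runs_While_True:
  assumes "test_val c s" "runs p s T1 (\<lambda>s'. runs (While c p) s' T2 Q)" "T1 + T2 < T"
  shows "runs (While c p) s T Q"
proof -
  from assms(2) obtain t s' t' s'' where
    "exec p s t s'" "t \<le> T1" "exec (While c p) s' t' s''" "t' \<le> T2" "Q s''"
    unfolding runs_def by blast
  with assms(1,3) show ?thesis
    by (intro runsI[OF exec.WhileTrue[of c s p t s' t' s'']]) auto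
qed

text \<open>The cost \<open>t k\<close> may vary with the iteration, since a pass places only some
  vertices. Each iteration pays for its test, and the final 1 for the failing test.\<close>

lemma runs_for:
  assumes "I 0 s"
    and step: "\<And>k s. k < N \<Longrightarrow> I k s \<Longrightarrow> test_val c s \<and> runs p s (t k) (I (Suc k))"
    and exit: "\<And>s. I N s \<Longrightarrow> \<not> test_val c s"
  shows "runs (While c p) s ((\<Sum>k<N. Suc (t k)) + 1) (I N)"
proof -
  \<comment> \<open>Induction on the number \<open>j\<close> of iterations left.\<close>
  have "runs (While c p) s ((\<Sum>k\<in>{N - j..<N}. Suc (t k)) + 1) (I N)" if "j \<le> N" "I (N - j) s" for j s
    using that
  proof (induction j arbitrary: s)
    case 0
    then show ?case using exit[of s] by (intro runs_While_False) auto
  next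
    case (Suc j)
    then have k: "N - Suc j < N" "Suc (N - Suc j) = N - j" by auto
    have "runs p s (t (N - Suc j))
        (\<lambda>s'. runs (While c p) s' ((\<Sum>k\<in>{N - j..<N}. Suc (t k)) + 1) (I N))"
      using step[OF k(1) Suc.prems(2)] k(2) Suc.IH Suc.prems(1) by (auto elim: runs_mono)
    moreover have "(\<Sum>k\<in>{N - Suc j..<N}. Suc (t k)) =
        Suc (t (N - Suc j)) + (\<Sum>k\<in>{N - j..<N}. Suc (t k))"
      using sum.atLeast_Suc_lessThan[OF k(1), of "\<lambda>k. Suc (t k)"] k(2) by simp
    ultimately show ?case
      using step[OF k(1) Suc.prems(2)] by (intro runs_While_True) auto
  qed
  from this[of N s] assms(1) show ?thesis by (simp add: atLeast0LessThan)
qed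

section \<open>First-fit colouring on the machine\<close>

text \<open>
  Register usage: \<open>0\<close> holds \<open>n\<close>, \<open>1\<close> the current vertex \<open>v\<close>, \<open>2\<close> its matrix row \<open>v * n\<close>,
  \<open>3\<close> holds \<open>n\<^sup>2\<close>, \<open>4\<close> is a pointer into the scanned list, \<open>5\<close> an address, \<open>6\<close> a flag for a neighbour
  found, \<open>7\<close> a flag for failure, \<open>8\<close> a counter.  For \<open>i < l\<close> register \<open>10 + i\<close> points behind the end
  of the \<open>i\<close>-th list and register \<open>10 + l + i\<close> holds the matrix row of the \<open>i\<close>-th clique vertex.
  The lists are interleaved: entry \<open>k\<close> of list \<open>i\<close> is stored in the cell \<open>n\<^sup>2 + i + k * l\<close>.
\<close>

definition scan_loop :: "nat \<Rightarrow> nat \<Rightarrow> prog" where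
  "scan_loop l i =
     While (Less (At (Reg 4)) (At (Reg (10 + i))))
       (Seq (Add (Reg 5) (At (Reg 2)) (At (Mem 4)))
         (If (Eq (At (Mem 5)) (Imm 1))
           (Seq (Add (Reg 6) (Imm 1) (Imm 0)) (Add (Reg 4) (At (Reg (10 + i))) (Imm 0)))
           (Add (Reg 4) (At (Reg 4)) (Imm l))))"

fun place_prog :: "nat \<Rightarrow> nat \<Rightarrow> nat \<Rightarrow> prog" where
  "place_prog l 0 i = Add (Reg 7) (Imm 1) (Imm 0)"
| "place_prog l (Suc m) i =
     Seq (Add (Reg 4) (At (Reg 3)) (Imm i))
    (Seq (Add (Reg 6) (Imm 0) (Imm 0))
    (Seq (scan_loop l i)
      (If (Eq (At (Reg 6)) (Imm 0))
        (Seq (Add (Mem (10 + i)) (At (Reg 1)) (Imm 0))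
             (Add (Reg (10 + i)) (At (Reg (10 + i))) (Imm l)))
        (place_prog l m (Suc i)))))"

definition matrix_rep :: "(nat \<Rightarrow> nat \<Rightarrow> bool) \<Rightarrow> nat \<Rightarrow> (nat \<Rightarrow> nat) \<Rightarrow> bool" where
  "matrix_rep A n m \<longleftrightarrow> (\<forall>u<n. \<forall>v<n. m (u * n + v) = (if A u v then 1 else 0))"

definition lists_rep :: "nat \<Rightarrow> nat \<Rightarrow> (nat \<Rightarrow> nat list) \<Rightarrow> (nat \<Rightarrow> nat) \<Rightarrow> (nat \<Rightarrow> nat) \<Rightarrow> bool" where
  "lists_rep n l L r m \<longleftrightarrow>
     (\<forall>i<l. set (L i) \<subseteq> {..<n} \<and> r (10 + i) = n * n + i + length (L i) * l \<and>
        (\<forall>k<length (L i). m (n * n + i + k * l) = L i ! k))"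

definition frame :: "nat set \<Rightarrow> (nat \<Rightarrow> nat) \<Rightarrow> (nat \<Rightarrow> nat) \<Rightarrow> bool" where
  "frame X r r' \<longleftrightarrow> (\<forall>j. j \<notin> X \<longrightarrow> r' j = r j)"

text \<open>A non-neighbour costs four steps: test, address, comparison, advance. The 6 pays for a
  neighbour ending the scan and the failing test after it.\<close>

lemma scan_loop_runs:
  assumes xs: "set xs \<subseteq> {..<n}" "\<forall>k<length xs. m (a + k * l) = xs ! k"
    and A: "matrix_rep A n m" "v < n" and l: "0 < l"
    and k: "k \<le> length xs" and r: "r 2 = v * n" "r 4 = a + k * l" "r (10 + i) = a + length xs * l"
  shows "runs (scan_loop l i) (r, m) (4 * length (filter (\<lambda>w. \<not> A v w) (drop k xs)) + 6)
    (\<lambda>(r', m'). m' = m \<and> frame {4, 5, 6} r r' \<and>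
       r' 6 = (if \<exists>w\<in>set (drop k xs). A v w then 1 else r 6))"
  using k r
proof (induction "length xs - k" arbitrary: k r)
  case 0
  then show ?case
    unfolding scan_loop_def by (intro runs_While_False) (auto simp: frame_def)
next
  case (Suc j)
  then have k: "k < length xs" by simp
  then have drop: "drop k xs = xs ! k # drop (Suc k) xs" by (simp add: Cons_nth_drop_Suc)
  have x: "m (a + k * l) = xs ! k" "xs ! k < n" using xs k nth_mem by blast+
  then have mem: "m (v * n + xs ! k) = (if A v (xs ! k) then 1 else 0)"
    using A by (simp add: matrix_rep_def)
  have test: "r 4 < r (10 + i)" using k l Suc.prems by simp
  show ?case
  proof (cases "A v (xs ! k)")
    case True
    show ?thesis unfolding scan_loop_def
      by (rule runs_While_True[where ?T1.0 = 4 and ?T2.0 = 1])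
        (use test Suc.prems x mem True drop in
          \<open>auto simp: frame_def intro!: runs_While_False\<close>)
  next
    case False
    let ?r = "r(5 := v * n + xs ! k, 4 := a + k * l + l)"
    have "runs (scan_loop l i) (?r, m)
      (4 * length (filter (\<lambda>w. \<not> A v w) (drop (Suc k) xs)) + 6)
      (\<lambda>(r', m'). m' = m \<and> frame {4, 5, 6} ?r r' \<and>
         r' 6 = (if \<exists>w\<in>set (drop (Suc k) xs). A v w then 1 else ?r 6))"
      by (rule Suc.hyps(1)) (use Suc.hyps(2) Suc.prems k in auto)
    then have "runs (scan_loop l i) (?r, m)
      (4 * length (filter (\<lambda>w. \<not> A v w) (drop (Suc k) xs)) + 6)
      (\<lambda>(r', m'). m' = m \<and> frame {4, 5, 6} r r' \<and>
         r' 6 = (if \<exists>w\<in>set (drop k xs). A v w then 1 else r 6))"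
      by (rule runs_mono) (use drop False in \<open>auto simp: frame_def\<close>)
    then show ?thesis unfolding scan_loop_def
      by (intro runs_While_True[where ?T1.0 = 3 and
            ?T2.0 = "4 * length (filter (\<lambda>w. \<not> A v w) (drop (Suc k) xs)) + 6"])
        (use test Suc.prems x mem False drop in auto)
  qed
qed

text \<open>Division with remainder by \<open>l\<close>: lists of any length never collide in
  memory.\<close>

lemma interleave_inj: "i < l \<Longrightarrow> j < l \<Longrightarrow> i + k * l = j + k' * l \<Longrightarrow> i = j \<and> k = (k'::nat)"
  by (metis add.commute div_mult_self3 div_less add_0 gr_implies_not0 mod_less mod_mult_self3)

lemma matrix_address: "u < n \<Longrightarrow> v < n \<Longrightarrow> u * n + v < n * (n::nat)"
  using mult_le_mono1[of "Suc u" n n] by simp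

lemma lists_rep_append:
  assumes "lists_rep n l L r m" "i < l" "v < n"
  shows "lists_rep n l (L(i := L i @ [v])) (r(10 + i := r (10 + i) + l)) (m(r (10 + i) := v))"
proof -
  have e: "r (10 + i) = n * n + i + length (L i) * l"
    using assms(1,2) by (simp add: lists_rep_def)
  have "(m(r (10 + i) := v)) (n * n + j + k * l) = (L(i := L i @ [v])) j ! k"
    if jk: "j < l" "k < length ((L(i := L i @ [v])) j)" for j k
  proof (cases "j = i \<and> k = length (L i)")
    case True
    then show ?thesis using e by simp
  next
    case False
    then have "n * n + j + k * l \<noteq> r (10 + i)"
      using e interleave_inj[OF jk(1) assms(2), of k "length (L i)"] by auto
    then show ?thesis
      using jk False assms(1) by (auto simp: lists_rep_def nth_append split: if_splits)
  qed
  then show ?thesis using assms e by (auto simp: lists_rep_def)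
qed

text \<open>Apart from the non-neighbours, a list costs two initialisations, at most 6 steps of
  scanning, one test and, if it is the right one, two steps to append: at most 11. The last 1 pays
  for the failure flag.\<close>

lemma place_prog_runs:
  assumes "lists_rep n l L r m" "matrix_rep A n m" "r 1 = v" "r 2 = v * n" "r 3 = n * n"
    "r 7 = (if b then 1 else 0)" "v < n" "i + k = l"
  shows "runs (place_prog l k i) (r, m)
    (4 * (\<Sum>j\<in>{i..<l}. length (filter (\<lambda>w. \<not> A v w) (L j))) + 11 * k + 1)
    (\<lambda>(r', m'). case place A v k i (L, b) of (L', b') \<Rightarrow>
       lists_rep n l L' r' m' \<and> matrix_rep A n m' \<and> r' 7 = (if b' then 1 else 0) \<and>
       frame ({4, 5, 6, 7} \<union> {10..<10 + l}) r r')"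
  using assms
proof (induction k arbitrary: i r)
  case 0
  then show ?case by (auto simp: frame_def lists_rep_def)
next
  case (Suc k)
  let ?f = "length (filter (\<lambda>w. \<not> A v w) (L i))"
  let ?F = "\<Sum>j\<in>{Suc i..<l}. length (filter (\<lambda>w. \<not> A v w) (L j))"
  let ?r = "r(4 := n * n + i, 6 := 0)"
  let ?Q = "\<lambda>(r', m'). case place A v (Suc k) i (L, b) of (L', b') \<Rightarrow>
       lists_rep n l L' r' m' \<and> matrix_rep A n m' \<and> r' 7 = (if b' then 1 else 0) \<and>
       frame ({4, 5, 6, 7} \<union> {10..<10 + l}) r r'"
  let ?rest = "If (Eq (At (Reg 6)) (Imm 0))
        (Seq (Add (Mem (10 + i)) (At (Reg 1)) (Imm 0))
             (Add (Reg (10 + i)) (At (Reg (10 + i))) (Imm l)))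
        (place_prog l k (Suc i))"
  have i: "i < l" using Suc.prems by simp
  have scan: "runs (scan_loop l i) (?r, m) (4 * ?f + 6)
    (\<lambda>(r', m'). m' = m \<and> frame {4, 5, 6} ?r r' \<and>
       r' 6 = (if \<exists>w\<in>set (L i). A v w then 1 else 0))"
  proof -
    have L: "set (L i) \<subseteq> {..<n}" "\<forall>k<length (L i). m (n * n + i + k * l) = L i ! k"
      "r (10 + i) = n * n + i + length (L i) * l"
      using Suc.prems(1) i unfolding lists_rep_def by blast+
    have "0 < l" using i by simp
    note scan_loop_runs[OF L(1,2) Suc.prems(2,7) this, of 0 ?r i]
    then show ?thesis by (rule runs_mono) (use L(3) Suc.prems(4) in auto)
  qed
  have "runs (scan_loop l i) (?r, m) (4 * ?f + 6) (\<lambda>s'. runs ?rest s' (4 * ?F + 11 * k + 2 + 1) ?Q)"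
  proof (rule runs_mono[OF scan order.refl], clarify)
    fix r' assume fr: "frame {4, 5, 6} ?r r'"
      and flag: "r' 6 = (if \<exists>w\<in>set (L i). A v w then 1 else 0)"
    have rep: "lists_rep n l L r' m" and r': "r' 1 = v" "r' 2 = v * n" "r' 3 = n * n"
        "r' 7 = (if b then 1 else 0)"
      using Suc.prems fr by (auto simp: lists_rep_def frame_def)
    show "runs ?rest (r', m) (4 * ?F + 11 * k + 2 + 1) ?Q"
    proof (cases "\<exists>w\<in>set (L i). A v w")
      case True
      have "runs (place_prog l k (Suc i)) (r', m) (4 * ?F + 11 * k + 1)
        (\<lambda>(r'', m'). case place A v k (Suc i) (L, b) of (L', b') \<Rightarrow>
           lists_rep n l L' r'' m' \<and> matrix_rep A n m' \<and> r'' 7 = (if b' then 1 else 0) \<and>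
           frame ({4, 5, 6, 7} \<union> {10..<10 + l}) r' r'')"
        by (rule Suc.IH) (use rep r' Suc.prems in auto)
      then have "runs (place_prog l k (Suc i)) (r', m) (4 * ?F + 11 * k + 2) ?Q"
        by (rule runs_mono) (use True fr in \<open>auto simp: frame_def split: prod.splits\<close>)
      with True flag show ?thesis by simp
    next
      case False
      have "r' (10 + i) = n * n + i + length (L i) * l" using rep i by (simp add: lists_rep_def)
      \<comment> \<open>The entry is written at an address of at least n * n, beyond the
        matrix.\<close>
      then have "matrix_rep A n (m(r' (10 + i) := v))"
        using Suc.prems(2) matrix_address[of _ n] by (fastforce simp: matrix_rep_def)
      moreover have "frame ({4, 5, 6, 7} \<union> {10..<10 + l}) r (r'(10 + i := r' (10 + i) + l))"
        using fr i by (auto simp: frame_def)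
      ultimately show ?thesis
        using False flag lists_rep_append[OF rep i Suc.prems(7)] r' by (simp add: fun_upd_def)
    qed
  qed
  then have "runs (Seq (scan_loop l i) ?rest) (?r, m) (4 * ?f + 4 * ?F + 11 * k + 9) ?Q"
    by (rule runs_Seq) simp
  moreover have "(\<Sum>j\<in>{i..<l}. length (filter (\<lambda>w. \<not> A v w) (L j))) = ?f + ?F"
    using i by (simp add: sum.atLeast_Suc_lessThan)
  ultimately have "runs (Seq (scan_loop l i) ?rest) (?r, m)
     (4 * (\<Sum>j\<in>{i..<l}. length (filter (\<lambda>w. \<not> A v w) (L j))) + 11 * Suc k + 1 - 2) ?Q"
    by (elim runs_mono) simp_all
  then show ?case using Suc.prems(5) by simp
qed

section \<open>Programs for the clique search and the two passes\<close>

fun count_prog :: "nat \<Rightarrow> nat \<Rightarrow> prog" where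
  "count_prog l 0 = Add (Reg 8) (Imm 0) (Imm 0)"
| "count_prog l (Suc k) =
     Seq (count_prog l k)
    (Seq (Add (Reg 5) (At (Reg (10 + l + k))) (At (Reg 1)))
         (Add (Reg 8) (At (Reg 8)) (At (Mem 5))))"

text \<open>The search tests no upper limit for the vertex: \<open>ex_common_nbr\<close> guarantees
  that it stops. The vertex found is placed at once, so the clique heads the first-fit
  order.\<close>

definition find_prog :: "nat \<Rightarrow> nat \<Rightarrow> prog" where
  "find_prog l k =
     Seq (Add (Reg 1) (Imm 0) (Imm 0))
    (Seq (Add (Reg 2) (Imm 0) (Imm 0))
    (Seq (count_prog l k)
    (Seq (While (Less (At (Reg 8)) (Imm k))
           (Seq (Add (Reg 1) (At (Reg 1)) (Imm 1))
           (Seq (Add (Reg 2) (At (Reg 2)) (At (Reg 0)))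
                (count_prog l k))))
    (Seq (Add (Reg (10 + l + k)) (At (Reg 2)) (Imm 0))
         (place_prog l l 0)))))"

fun clique_prog :: "nat \<Rightarrow> nat \<Rightarrow> prog" where
  "clique_prog l 0 = Skip"
| "clique_prog l (Suc k) = Seq (clique_prog l k) (find_prog l k)"

text \<open>\<open>b\<close> selects the good vertices or the others. Recomputing goodness in each
  of two passes avoids storing the order.\<close>

definition pass_prog :: "nat \<Rightarrow> bool \<Rightarrow> prog" where
  "pass_prog l b =
     Seq (Add (Reg 1) (Imm 0) (Imm 0))
    (Seq (Add (Reg 2) (Imm 0) (Imm 0))
         (While (Less (At (Reg 1)) (At (Reg 0)))
           (Seq (count_prog l l)
           (Seq (If (Less (At (Reg 8)) (Imm (l - 1)))
                  (if b then Skip else place_prog l l 0)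
                  (if b then place_prog l l 0 else Skip))
           (Seq (Add (Reg 1) (At (Reg 1)) (Imm 1))
                (Add (Reg 2) (At (Reg 2)) (At (Reg 0))))))))"

text \<open>Repeated addition, as the machine cannot multiply.\<close>

definition square_prog :: prog where
  "square_prog =
     While (Less (At (Reg 1)) (At (Reg 0)))
       (Seq (Add (Reg 3) (At (Reg 3)) (At (Reg 0)))
            (Add (Reg 1) (At (Reg 1)) (Imm 1)))"

fun ends_prog :: "nat \<Rightarrow> prog" where
  "ends_prog 0 = Skip"
| "ends_prog (Suc k) = Seq (ends_prog k) (Add (Reg (10 + k)) (At (Reg 3)) (Imm k))"

definition main_prog :: "nat \<Rightarrow> prog" where
  "main_prog l =
     Seq square_prog
    (Seq (ends_prog l)
    (Seq (clique_prog l l)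
    (Seq (pass_prog l True)
    (Seq (pass_prog l False)
         (If (Eq (At (Reg 7)) (Imm 0)) Skip (Add (Reg 0) (Imm 0) (Imm 0)))))))"

lemma square_prog_runs:
  "runs square_prog (\<lambda>i. if i = 0 then n else 0, m) (3 * n + 1)
     (\<lambda>(r, m'). m' = m \<and> r 0 = n \<and> r 3 = n * n \<and> r 7 = 0)"
proof -
  let ?I = "\<lambda>k (r, m'). m' = m \<and> r 0 = n \<and> r 1 = k \<and> r 3 = k * n \<and> r (7::nat) = (0::nat)"
  have "runs square_prog (\<lambda>i. if i = 0 then n else 0, m) ((\<Sum>k<n. Suc 2) + 1) (?I n)"
    unfolding square_prog_def by (rule runs_for) auto
  then show ?thesis by (rule runs_mono) auto
qed

lemma ends_prog_runs:
  "r 3 = a \<Longrightarrow> runs (ends_prog k) (r, m) k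
     (\<lambda>(r', m'). m' = m \<and> frame {10..<10 + k} r r' \<and> (\<forall>i<k. r' (10 + i) = a + i))"
proof (induction k)
  case 0
  then show ?case by (simp add: frame_def)
next
  case (Suc k)
  show ?case unfolding ends_prog.simps
    by (rule runs_Seq[where ?T2.0 = 1, OF runs_mono[OF Suc.IH[OF Suc.prems] order.refl]])
      (use Suc.prems in \<open>auto simp: frame_def less_Suc_eq\<close>)
qed

text \<open>Matrix entries are 0 or 1, so summing column \<open>v\<close> over the stored rows
  counts neighbours without branching.\<close>

lemma count_prog_runs:
  assumes "matrix_rep A n m" "v < n" "r 1 = v" "\<forall>i<k. x i < n \<and> r (10 + l + i) = x i * n"
  shows "runs (count_prog l k) (r, m) (2 * k + 1)
    (\<lambda>(r', m'). m' = m \<and> frame {5, 8} r r' \<and> r' 8 = card {i. i < k \<and> A (x i) v})"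
  using assms(4)
proof (induction k)
  case 0
  then show ?case by (simp add: frame_def)
next
  case (Suc k)
  have mem: "m (x k * n + v) = (if A (x k) v then 1 else 0)"
    using assms(1,2) Suc.prems by (simp add: matrix_rep_def)
  have "{i. i < Suc k \<and> A (x i) v} =
      (if A (x k) v then insert k {i. i < k \<and> A (x i) v} else {i. i < k \<and> A (x i) v})"
    by (auto simp: less_Suc_eq)
  then have card: "card {i. i < Suc k \<and> A (x i) v} =
      card {i. i < k \<and> A (x i) v} + (if A (x k) v then 1 else 0)" by simp
  from Suc have IH: "runs (count_prog l k) (r, m) (2 * k + 1)
    (\<lambda>(r', m'). m' = m \<and> frame {5, 8} r r' \<and> r' 8 = card {i. i < k \<and> A (x i) v})" by simp
  show ?case unfolding count_prog.simps
    by (rule runs_Seq[where ?T2.0 = 2, OF runs_mono[OF IH order.refl]])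
      (use Suc.prems assms(3) mem card in \<open>auto simp: frame_def\<close>)
qed

section \<open>Running time of the first-fit algorithm\<close>

locale ram_graph = dense_graph "{..<n}" A l d for n :: nat and A l d
begin

definition state_rep :: "nat list \<Rightarrow> (nat \<Rightarrow> nat) \<Rightarrow> (nat \<Rightarrow> nat) \<Rightarrow> bool" where
  "state_rep vs r m \<longleftrightarrow> r 0 = n \<and> r 3 = n * n \<and> matrix_rep A n m \<and>
     (case first_fit A l vs of (L, b) \<Rightarrow> lists_rep n l L r m \<and> r 7 = (if b then 1 else 0))"

definition clique_rep :: "(nat \<Rightarrow> nat) \<Rightarrow> nat \<Rightarrow> (nat \<Rightarrow> nat) \<Rightarrow> bool" where
  "clique_rep x k r \<longleftrightarrow> (\<forall>i<k. x i < n \<and> r (10 + l + i) = x i * n)"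

lemma state_rep_frame:
  assumes "frame X r r'" "state_rep vs r m" "X \<inter> ({0, 3, 7} \<union> {10..<10 + l}) = {}"
  shows "state_rep vs r' m"
proof -
  have "10 + i \<notin> X" if "i < l" for i using assms(3) that by (auto simp: disjoint_iff)
  then have "r' 0 = r 0" "r' 3 = r 3" "r' 7 = r 7" "\<forall>i<l. r' (10 + i) = r (10 + i)"
    using assms(1,3) by (auto simp: frame_def)
  then show ?thesis
    using assms(2) unfolding state_rep_def lists_rep_def by (simp split: prod.splits)
qed

lemma clique_rep_frame:
  assumes "frame X r r'" "clique_rep x k r" "X \<inter> {10 + l..} = {}"
  shows "clique_rep x k r'"
proof -
  have "10 + l + i \<notin> X" for i using assms(3) by (auto simp: disjoint_iff)
  then show ?thesis using assms(1,2) by (simp add: clique_rep_def frame_def)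
qed

text \<open>At most l + d non-neighbours are read at four steps each, and 11l + 1 steps of overhead
  remain.\<close>

lemma place_runs:
  assumes "state_rep (us @ vs) r m" "r 1 = v" "r 2 = v * n" "v < n"
    "length us \<le> l" "distinct vs" "set vs \<subseteq> {..<n}"
  shows "runs (place_prog l l 0) (r, m) (4 * d + 15 * l + 1)
    (\<lambda>(r', m'). state_rep (us @ vs @ [v]) r' m' \<and> frame ({4, 5, 6, 7} \<union> {10..<10 + l}) r r')"
proof -
  obtain L b where L: "first_fit A l (us @ vs) = (L, b)" by fastforce
  have len: "(\<Sum>i<l. length (filter (\<lambda>w. \<not> A v w) (L i))) \<le> l + d"
    using nonadj_entries_le[OF L assms(5,6,7), of v] assms(4) by simp
  have ff: "first_fit A l (us @ vs @ [v]) = place A v l 0 (L, b)"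
    using first_fit_snoc[of A l "us @ vs" v] L by simp
  have "runs (place_prog l l 0) (r, m)
    (4 * (\<Sum>j\<in>{0..<l}. length (filter (\<lambda>w. \<not> A v w) (L j))) + 11 * l + 1)
    (\<lambda>(r', m'). case place A v l 0 (L, b) of (L', b') \<Rightarrow>
       lists_rep n l L' r' m' \<and> matrix_rep A n m' \<and> r' 7 = (if b' then 1 else 0) \<and>
       frame ({4, 5, 6, 7} \<union> {10..<10 + l}) r r')"
    by (rule place_prog_runs) (use assms L in \<open>auto simp: state_rep_def\<close>)
  then show ?thesis
    by (rule runs_mono)
      (use len assms(1) in \<open>auto simp: ff state_rep_def frame_def atLeast0LessThan split: prod.splits\<close>)
qed

lemma find_runs:
  assumes "state_rep (map x [0..<k]) r m" "clique x k" "clique_rep x k r" "k < l"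
  shows "runs (find_prog l k) (r, m) (n * (2 * l + 2) + 4 * d + 17 * l + 4)
    (\<lambda>(r', m'). \<exists>x. clique x (Suc k) \<and> state_rep (map x [0..<Suc k]) r' m' \<and> clique_rep x (Suc k) r')"
proof -
  let ?c = "\<lambda>v. card {i. i < k \<and> A (x i) v}"
  \<comment> \<open>The vertex at which the search stops; by minimality the loop test succeeds at
    all earlier vertices.\<close>
  define y where "y = (LEAST v. v < n \<and> k \<le> ?c v)"
  have full: "k \<le> ?c v \<longleftrightarrow> (\<forall>i<k. A (x i) v)" for v
  proof
    assume "k \<le> ?c v"
    then have "{i. i < k \<and> A (x i) v} = {..<k}" by (intro card_seteq) auto
    then show "\<forall>i<k. A (x i) v" by blast
  next
    assume "\<forall>i<k. A (x i) v"
    then have "{i. i < k \<and> A (x i) v} = {..<k}" by auto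
    then show "k \<le> ?c v" by simp
  qed
  from ex_common_nbr[OF assms(2,4)] have "\<exists>v. v < n \<and> k \<le> ?c v" unfolding full by auto
  then have y: "y < n" "k \<le> ?c y" unfolding y_def by (rule LeastI2_ex; simp)+
  have less: "?c v < k" if "v < y" for v
    using not_less_Least[OF that[unfolded y_def]] that y(1) by auto
  let ?I = "\<lambda>v (r', m'). m' = m \<and> frame {1, 2, 5, 8} r r' \<and> r' 1 = v \<and> r' 2 = v * n \<and> r' 8 = ?c v"
  have count: "runs (count_prog l k) (r', m') (2 * k + 1) (?I v)"
    if r': "m' = m" "frame {1, 2, 5, 8} r r'" "r' 1 = v" "r' 2 = v * n" "v < n" for r' m' v
  proof -
    have "clique_rep x k r'" using r'(2) assms(3) by (rule clique_rep_frame) auto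
    then have "runs (count_prog l k) (r', m) (2 * k + 1)
        (\<lambda>(r'', m'). m' = m \<and> frame {5, 8} r' r'' \<and> r'' 8 = ?c v)"
      using assms(1) r' by (intro count_prog_runs) (auto simp: state_rep_def clique_rep_def)
    then show ?thesis unfolding r'(1) by (rule runs_mono) (use r' in \<open>auto simp: frame_def\<close>)
  qed
  let ?body = "Seq (Add (Reg 1) (At (Reg 1)) (Imm 1))
           (Seq (Add (Reg 2) (At (Reg 2)) (At (Reg 0))) (count_prog l k))"
  let ?Q = "\<lambda>(r', m'). \<exists>x. clique x (Suc k) \<and> state_rep (map x [0..<Suc k]) r' m' \<and>
    clique_rep x (Suc k) r'"
  have loop: "runs (While (Less (At (Reg 8)) (Imm k)) ?body) s ((\<Sum>v<y. Suc (2 * k + 3)) + 1) (?I y)"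
    if "?I 0 s" for s
  proof (rule runs_for)
    fix v s assume v: "v < y" "?I v s"
    obtain r' m' where s: "s = (r', m')" by fastforce
    have r0: "r' 0 = n" using v(2) assms(1) by (simp add: s frame_def state_rep_def)
    have "runs (count_prog l k) (r'(1 := Suc v, 2 := v * n + n), m') (2 * k + 1) (?I (Suc v))"
      by (rule count) (use v y(1) in \<open>auto simp: s frame_def\<close>)
    then show "test_val (Less (At (Reg 8)) (Imm k)) s \<and> runs ?body s (2 * k + 3) (?I (Suc v))"
      using v less[OF v(1)] r0 by (simp add: s)
  qed (use that y(2) in auto)
  have last: "runs (Seq (Add (Reg (10 + l + k)) (At (Reg 2)) (Imm 0)) (place_prog l l 0)) s
      (4 * d + 15 * l + 2) ?Q" if Iy: "?I y s" for s
  proof -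
    obtain r' where s: "s = (r', m)" and r': "frame {1, 2, 5, 8} r r'" "r' 1 = y" "r' 2 = y * n"
      using Iy by (cases s) auto
    let ?r = "r'(10 + l + k := y * n)"
    have "state_rep (map x [0..<k]) ?r m"
      by (rule state_rep_frame[of "{1, 2, 5, 8, 10 + l + k}", OF _ assms(1)])
        (use r' in \<open>auto simp: frame_def\<close>)
    then have "runs (place_prog l l 0) (?r, m) (4 * d + 15 * l + 1)
      (\<lambda>(r', m'). state_rep (map x [0..<k] @ [] @ [y]) r' m' \<and>
         frame ({4, 5, 6, 7} \<union> {10..<10 + l}) ?r r')"
      by (intro place_runs) (use r' y assms(4) in auto)
    then have "runs (place_prog l l 0) (?r, m) (4 * d + 15 * l + 1) ?Q"
    proof (rule runs_mono, goal_cases)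
      case (2 s')
      obtain r'' m'' where s': "s' = (r'', m'')" by fastforce
      from 2 have rep: "state_rep (map x [0..<k] @ [y]) r'' m''"
        and fr: "frame ({4, 5, 6, 7} \<union> {10..<10 + l}) ?r r''" by (auto simp: s')
      have "clique (x(k := y)) (Suc k)"
        using assms(2) y by (auto simp: clique_def less_Suc_eq full intro: A_sym)
      moreover have "clique_rep (x(k := y)) (Suc k) r''"
        using assms(3) y(1) r'(1) fr by (auto simp: clique_rep_def frame_def less_Suc_eq)
      moreover have "map (x(k := y)) [0..<Suc k] = map x [0..<k] @ [y]" by simp
      ultimately show ?case using rep by (auto simp: s' simp del: upt_Suc)
    qed simp
    then show ?thesis using r' by (simp add: s)
  qed
  have "runs (count_prog l k) (r(1 := 0, 2 := 0), m) (2 * k + 1) (?I 0)"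
    by (rule count) (use y(1) in \<open>auto simp: frame_def\<close>)
  then have "runs (Seq (count_prog l k) (Seq (While (Less (At (Reg 8)) (Imm k)) ?body)
      (Seq (Add (Reg (10 + l + k)) (At (Reg 2)) (Imm 0)) (place_prog l l 0))))
      (r(1 := 0, 2 := 0), m) (2 * k + 1 + ((\<Sum>v<y. Suc (2 * k + 3)) + 1 + (4 * d + 15 * l + 2))) ?Q"
    by (intro runs_Seq[OF runs_mono[OF _ order.refl] order.refl] runs_Seq[OF runs_mono[OF loop order.refl] order.refl] last)
  \<comment> \<open>Here k < l gives 2k + 4 \<le> 2l + 2.\<close>
  moreover have "(\<Sum>v<y. Suc (2 * k + 3)) \<le> n * (2 * l + 2)"
    using mult_le_mono[of y n "2 * k + 4" "2 * l + 2"] y(1) assms(4) by (simp add: add.commute)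
  then have "2 * k + 1 + ((\<Sum>v<y. Suc (2 * k + 3)) + 1 + (4 * d + 15 * l + 2)) \<le>
      n * (2 * l + 2) + 4 * d + 17 * l + 4 - 2"
    using assms(4) by linarith
  ultimately show ?thesis unfolding find_prog_def using runs_mono by (simp add: assms) 
qed

lemma clique_runs:
  assumes "state_rep [] r m" "k \<le> l"
  shows "runs (clique_prog l k) (r, m) (k * (n * (2 * l + 2) + 4 * d + 17 * l + 4))
    (\<lambda>(r', m'). \<exists>x. clique x k \<and> state_rep (map x [0..<k]) r' m' \<and> clique_rep x k r')"
  using assms(2)
proof (induction k)
  case 0
  then show ?case using assms(1) by (simp add: clique_def clique_rep_def)
next
  case (Suc k)
  then have IH: "runs (clique_prog l k) (r, m) (k * (n * (2 * l + 2) + 4 * d + 17 * l + 4))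
    (\<lambda>(r', m'). \<exists>x. clique x k \<and> state_rep (map x [0..<k]) r' m' \<and> clique_rep x k r')" by simp
  show ?case unfolding clique_prog.simps
    by (rule runs_Seq[where ?T2.0 = "n * (2 * l + 2) + 4 * d + 17 * l + 4", OF runs_mono[OF IH order.refl]])
      (use Suc.prems find_runs in auto)
qed

text \<open>The cost of placing is charged only to selected vertices, so that the two passes
  together pay for each vertex once and the leading term is 4nd rather than 8nd.\<close>

lemma pass_runs:
  assumes "state_rep (us @ vs) r m" "clique_rep x l r"
    "length us \<le> l" "distinct (vs @ filter (\<lambda>v. good x v = b) [0..<n])" "set vs \<subseteq> {..<n}"
  shows "runs (pass_prog l b) (r, m)
    ((\<Sum>v<n. 2 * l + 5 + (if good x v = b then 4 * d + 15 * l + 1 else 0)) + 3)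
    (\<lambda>(r', m'). state_rep (us @ vs @ filter (\<lambda>v. good x v = b) [0..<n]) r' m' \<and> clique_rep x l r')"
proof -
  let ?t = "\<lambda>v. if good x v = b then 4 * d + 15 * l + 1 else 0"
  let ?I = "\<lambda>v (r', m'). state_rep (us @ vs @ filter (\<lambda>v. good x v = b) [0..<v]) r' m' \<and>
    clique_rep x l r' \<and> r' 1 = v \<and> r' 2 = v * n"
  let ?inc = "Seq (Add (Reg 1) (At (Reg 1)) (Imm 1)) (Add (Reg 2) (At (Reg 2)) (At (Reg 0)))"
  let ?if = "If (Less (At (Reg 8)) (Imm (l - 1)))
     (if b then Skip else place_prog l l 0) (if b then place_prog l l 0 else Skip)"
  let ?body = "Seq (count_prog l l) (Seq ?if ?inc)"
  have body: "runs ?body (r', m') (2 * l + 1 + (1 + ?t v + 2)) (?I (Suc v))"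
    if v: "v < n" "?I v (r', m')" for v r' m'
  proof (rule runs_Seq[OF _ order.refl])
    have "runs (count_prog l l) (r', m') (2 * l + 1)
        (\<lambda>(r'', m''). m'' = m' \<and> frame {5, 8} r' r'' \<and> r'' 8 = card {i. i < l \<and> A (x i) v})"
      using v by (intro count_prog_runs) (auto simp: state_rep_def clique_rep_def)
    then show "runs (count_prog l l) (r', m') (2 * l + 1)
        (\<lambda>s'. runs (Seq ?if ?inc) s' (1 + ?t v + 2) (?I (Suc v)))"
    proof (rule runs_mono, goal_cases)
      case (2 s)
      then obtain r'' where s: "s = (r'', m')" and fr: "frame {5, 8} r' r''"
        and cnt: "r'' 8 = card {i. i < l \<and> A (x i) v}" by (cases s) auto
      let ?ws = "vs @ filter (\<lambda>v. good x v = b) [0..<v]"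
      have rep: "state_rep (us @ ?ws) r'' m'"
        using v(2) fr by (auto intro: state_rep_frame)
      have xrep: "clique_rep x l r''" using v(2) by (auto intro: clique_rep_frame[OF fr])
      have r'': "r'' 1 = v" "r'' 2 = v * n" using v(2) fr by (auto simp: frame_def)
      let ?J = "\<lambda>(r', m'). state_rep (us @ vs @ filter (\<lambda>v. good x v = b) [0..<Suc v]) r' m' \<and>
        clique_rep x l r' \<and> r' 1 = v \<and> r' 2 = v * n"
      have "runs ?if s (1 + ?t v) ?J"
      proof (cases "good x v = b")
        case True
        have "[0..<n] = [0..<v] @ [v..<n]" using v(1) upt_add_eq_append[of 0 v "n - v"] by simp
        then have "distinct ?ws" using assms(4) by auto
        then have "runs (place_prog l l 0) (r'', m') (4 * d + 15 * l + 1)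
          (\<lambda>(r', m'). state_rep (us @ ?ws @ [v]) r' m' \<and>
             frame ({4, 5, 6, 7} \<union> {10..<10 + l}) r'' r')"
          by (intro place_runs) (use rep r'' v(1) assms(3,5) in auto)
        then have "runs (place_prog l l 0) (r'', m') (4 * d + 15 * l + 1) ?J"
        proof (rule runs_mono, goal_cases)
          case (2 s')
          then obtain r1 m1 where s': "s' = (r1, m1)" "state_rep (us @ ?ws @ [v]) r1 m1"
            and fr1: "frame ({4, 5, 6, 7} \<union> {10..<10 + l}) r'' r1" by (cases s') auto
          have "clique_rep x l r1" by (rule clique_rep_frame[OF fr1 xrep]) auto
          moreover have "r1 1 = r'' 1" "r1 2 = r'' 2" using fr1 by (auto simp: frame_def)
          ultimately show ?case using True r'' s' by simp
        qed simp
        then show ?thesis using True cnt by (auto simp: s good_def)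
      next
        case False
        then show ?thesis using cnt rep xrep r'' by (auto simp: s good_def)
      qed
      then show ?case
      proof (rule runs_Seq[OF runs_mono[OF _ order.refl] order.refl], goal_cases)
        case (1 s')
        obtain r1 m1 where s': "s' = (r1, m1)" by fastforce
        let ?r = "r1(1 := Suc v, 2 := v * n + n)"
        have fr: "frame {1, 2} r1 ?r" by (simp add: frame_def)
        have "state_rep (us @ vs @ filter (\<lambda>v. good x v = b) [0..<Suc v]) ?r m1"
          "clique_rep x l ?r" "r1 0 = n" "r1 1 = v" "r1 2 = v * n"
          using 1 state_rep_frame[OF fr] clique_rep_frame[OF fr]
          by (auto simp: s' state_rep_def simp del: upt_Suc)
        then show ?case by (simp add: s' del: upt_Suc)
      qed
    qed simp
  qed
  have "runs (While (Less (At (Reg 1)) (At (Reg 0))) ?body) (r(1 := 0, 2 := 0), m)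
    ((\<Sum>v<n. Suc (2 * l + 1 + (1 + ?t v + 2))) + 1) (?I n)"
  proof (rule runs_for[where I = ?I])
    have fr: "frame {1, 2} r (r(1 := 0, 2 := 0))" by (simp add: frame_def)
    show "?I 0 (r(1 := 0, 2 := 0), m)"
      using assms(1,2) state_rep_frame[OF fr] clique_rep_frame[OF fr] by auto
    fix v s assume v: "v < n" "?I v s"
    obtain r' m' where s: "s = (r', m')" by fastforce
    show "test_val (Less (At (Reg 1)) (At (Reg 0))) s \<and>
        runs ?body s (2 * l + 1 + (1 + ?t v + 2)) (?I (Suc v))"
      using body[OF v(1) v(2)[unfolded s]] v by (simp add: s state_rep_def)
  qed (auto simp: state_rep_def)
  then have "runs (While (Less (At (Reg 1)) (At (Reg 0))) ?body) (r(1 := 0, 2 := 0), m)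
    ((\<Sum>v<n. 2 * l + 5 + ?t v) + 3 - 1 - 1)
    (\<lambda>(r', m'). state_rep (us @ vs @ filter (\<lambda>v. good x v = b) [0..<n]) r' m' \<and> clique_rep x l r')"
  proof (rule runs_mono, goal_cases)
    case 1
    have "(\<Sum>v<n. Suc (2 * l + 1 + (1 + ?t v + 2))) = (\<Sum>v<n. 2 * l + 5 + ?t v)"
      by (intro sum.cong) auto
    then show ?case by simp
  qed auto
  then show ?thesis by (simp add: pass_prog_def)
qed

text \<open>Only the placements in the passes cost order n d; for fixed \<open>l\<close> all else,
  including the clique search, is linear in \<open>n\<close>.\<close>

theorem main_runs:
  assumes "0 < n" "d \<le> n" "matrix_rep A n m" "0 < l"
  shows "runs (main_prog l) (\<lambda>i. if i = 0 then n else 0, m)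
    (4 * n * d + (19 * l * l + 31 * l + 25) * n)
    (\<lambda>(r, m). r 0 \<noteq> 0 \<longleftrightarrow> (\<exists>\<phi>. colouring \<phi>))"
proof -
  let ?T = "4 * d + 15 * l + 1"
  let ?Q = "\<lambda>(r, m). r (0::nat) \<noteq> (0::nat) \<longleftrightarrow> (\<exists>\<phi>. colouring \<phi>)"
  let ?fin = "If (Eq (At (Reg 7)) (Imm 0)) Skip (Add (Reg 0) (Imm 0) (Imm 0))"
  let ?pass = "\<lambda>x b. (\<Sum>v<n. 2 * l + 5 + (if good x v = b then ?T else 0)) + 3"
  let ?clique = "l * (n * (2 * l + 2) + 4 * d + 17 * l + 4)"
  have fin: "runs ?fin (r, m') 2 ?Q" if "state_rep (clique_first x [0..<n]) r m'" "clique x l" for r m' x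
    using first_fit_correct[OF that(2), of "[0..<n]"] that(1) assms(1)
    by (auto simp: state_rep_def lessThan_atLeast0 split: prod.splits)
  have both: "?pass x True + ?pass x False = n * (4 * l + 10) + n * ?T + 6" for x
  proof -
    have "(\<Sum>v<n. 2 * l + 5 + (if good x v = True then ?T else 0)) +
        (\<Sum>v<n. 2 * l + 5 + (if good x v = False then ?T else 0)) = (\<Sum>v<n. 4 * l + 10 + ?T)"
      unfolding sum.distrib[symmetric] by (intro sum.cong) auto
    then show ?thesis by (simp add: algebra_simps)
  qed
  have passes: "runs (Seq (pass_prog l True) (Seq (pass_prog l False) ?fin)) (r, m')
      (n * (4 * l + 10) + n * ?T + 8) ?Q"
    if x: "clique x l" "state_rep (map x [0..<l]) r m'" "clique_rep x l r" for r m' x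
  proof (rule runs_Seq)
    let ?g = "filter (\<lambda>v. good x v = True) [0..<n]" and ?h = "filter (\<lambda>v. good x v = False) [0..<n]"
    have p1: "runs (pass_prog l True) (r, m') (?pass x True)
      (\<lambda>(r', m'). state_rep (map x [0..<l] @ [] @ ?g) r' m' \<and> clique_rep x l r')"
      by (rule pass_runs) (use x in auto)
    have p2: "runs (pass_prog l False) (r', m') (?pass x False)
      (\<lambda>(r', m'). state_rep (map x [0..<l] @ ?g @ ?h) r' m' \<and> clique_rep x l r')"
      if "state_rep (map x [0..<l] @ [] @ ?g) r' m'" "clique_rep x l r'" for r' m'
      by (rule pass_runs) (use that in auto)
    have "runs (Seq (pass_prog l False) ?fin) (r', m') (?pass x False + 2) ?Q"
      if "state_rep (map x [0..<l] @ [] @ ?g) r' m'" "clique_rep x l r'" for r' m'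
      by (rule runs_Seq[OF runs_mono[OF p2[OF that] order.refl] order.refl])
        (clarify, rule fin[OF _ x(1)], simp add: clique_first_def)
    then show "runs (pass_prog l True) (r, m') (?pass x True)
        (\<lambda>s'. runs (Seq (pass_prog l False) ?fin) s' (?pass x False + 2) ?Q)"
      by (intro runs_mono[OF p1 order.refl]) auto
    show "?pass x True + (?pass x False + 2) \<le> n * (4 * l + 10) + n * ?T + 8"
      using both[of x] by simp
  qed
  let ?P = "n * (4 * l + 10) + n * ?T + 8"
  have cl: "runs (Seq (clique_prog l l) (Seq (pass_prog l True) (Seq (pass_prog l False) ?fin)))
      (r, m) (?clique + ?P) ?Q" if "state_rep [] r m" for r
    by (rule runs_Seq[OF runs_mono[OF clique_runs[OF that order.refl] order.refl] order.refl])
      (use passes in auto)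
  have init: "state_rep [] r' m" if "r 0 = n" "r 3 = n * n" "r 7 = 0" "frame {10..<10 + l} r r'"
      "\<forall>i<l. r' (10 + i) = n * n + i" for r r'
    using that assms(3) by (auto simp: state_rep_def lists_rep_def frame_def)
  have "runs (Seq (ends_prog l) (Seq (clique_prog l l)
      (Seq (pass_prog l True) (Seq (pass_prog l False) ?fin)))) (r, m) (l + (?clique + ?P)) ?Q"
    if "r 0 = n" "r 3 = n * n" "r 7 = 0" for r
    by (rule runs_Seq[OF runs_mono[OF ends_prog_runs[where r = r, OF that(2)] order.refl] order.refl])
      (use cl init[OF that] in auto)
  then have "runs (main_prog l) (\<lambda>i. if i = 0 then n else 0, m) (3 * n + 1 + (l + (?clique + ?P))) ?Q"
    unfolding main_prog_def
    by (intro runs_Seq[OF runs_mono[OF square_prog_runs order.refl] order.refl]) auto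
  moreover have "3 * n + 1 + (l + (?clique + ?P)) \<le> 4 * n * d + (19 * l * l + 31 * l + 25) * n"
  proof -
    \<comment> \<open>With n \<ge> 1 and d \<le> n, every term free of \<open>n\<close> is absorbed
      into a multiple of \<open>n\<close>.\<close>
    have "l * (4 * d + 17 * l + 4) \<le> l * (4 * n + 17 * l * n + 4 * n)"
      using assms(1,2) mult_le_mono2[of 1 n "17 * l"] by (intro mult_le_mono2) linarith
    moreover have "l \<le> l * n" using assms(1) by simp
    moreover have "3 * n + 1 + (l + (?clique + ?P)) = 3 * n + l + 9 + l * n * (2 * l + 2) +
        l * (4 * d + 17 * l + 4) + n * (4 * l + 10) + n * ?T"
      by (simp add: algebra_simps)
    ultimately have "3 * n + 1 + (l + (?clique + ?P)) \<le> 12 * n + l * n + l * n * (2 * l + 2) +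
        l * (4 * n + 17 * l * n + 4 * n) + n * (4 * l + 10) + n * ?T"
      using assms(1) by linarith
    also have "\<dots> \<le> 4 * n * d + (19 * l * l + 31 * l + 25) * n" by (simp add: algebra_simps)
    finally show ?thesis .
  qed
  ultimately show ?thesis by (elim runs_mono)
qed

end

section \<open>Small inputs by table lookup\<close>

text \<open>A decision tree whose leaves have the answer built in, so \<open>P\<close> costs no
  time. Register 1 is the running address; register 0 still holds a nonzero \<open>n\<close> unless
  the answer is no.\<close>

fun table_prog :: "nat \<Rightarrow> (bool list \<Rightarrow> bool) \<Rightarrow> prog" where
  "table_prog 0 P = (if P [] then Skip else Add (Reg 0) (Imm 0) (Imm 0))"
| "table_prog (Suc k) P =
     If (Eq (At (Mem 1)) (Imm 1))
       (Seq (Add (Reg 1) (At (Reg 1)) (Imm 1)) (table_prog k (\<lambda>bs. P (True # bs))))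
       (Seq (Add (Reg 1) (At (Reg 1)) (Imm 1)) (table_prog k (\<lambda>bs. P (False # bs))))"

lemma table_prog_runs:
  "r 0 \<noteq> 0 \<Longrightarrow> runs (table_prog k P) (r, m) (2 * k + 1)
     (\<lambda>(r', m'). r' 0 \<noteq> 0 \<longleftrightarrow> P (map (\<lambda>i. m i = 1) [r 1..<r 1 + k]))"
proof (induction k arbitrary: P r)
  case 0
  then show ?case by simp
next
  case (Suc k)
  have "[r 1..<r 1 + Suc k] = r 1 # [Suc (r 1)..<Suc (r 1) + k]" by (simp add: upt_conv_Cons)
  moreover have "(r(1 := Suc (r 1))) 0 \<noteq> 0" using Suc.prems by simp
  note IH = Suc.IH[where r = "r(1 := Suc (r 1))", OF this]
  note IH[of "\<lambda>bs. P (True # bs)"] IH[of "\<lambda>bs. P (False # bs)"]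
  ultimately show ?case by (simp add: fun_upd_def del: upt_Suc)
qed

text \<open>Testing the constants in increasing order makes a hit cost about \<open>n\<close> steps
  instead of the whole threshold, which keeps tiny inputs within the bound.\<close>

fun dispatch_prog :: "prog \<Rightarrow> (nat \<Rightarrow> prog) \<Rightarrow> nat \<Rightarrow> nat \<Rightarrow> prog" where
  "dispatch_prog p f 0 i = p"
| "dispatch_prog p f (Suc j) i = If (Eq (At (Reg 0)) (Imm i)) (f i) (dispatch_prog p f j (Suc i))"

lemma dispatch_prog_small:
  "r 0 = n \<Longrightarrow> i \<le> n \<Longrightarrow> n < i + j \<Longrightarrow> runs (f n) (r, m) T Q \<Longrightarrow>
     runs (dispatch_prog p f j i) (r, m) (n - i + 1 + T) Q"
proof (induction j arbitrary: i)
  case 0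
  then show ?case by simp
next
  case (Suc j)
  show ?case
  proof (cases "i = n")
    case True
    with Suc.prems show ?thesis by simp
  next
    case False
    with Suc.prems have "runs (dispatch_prog p f j (Suc i)) (r, m) (n - Suc i + 1 + T) Q"
      by (intro Suc.IH) auto
    with False Suc.prems show ?thesis by (simp add: Suc_diff_Suc)
  qed
qed

lemma dispatch_prog_large:
  "r 0 = n \<Longrightarrow> i + j \<le> n \<Longrightarrow> runs p (r, m) T Q \<Longrightarrow>
     runs (dispatch_prog p f j i) (r, m) (j + T) Q"
proof (induction j arbitrary: i)
  case (Suc j)
  from Suc.prems have "runs (dispatch_prog p f j (Suc i)) (r, m) (j + T) Q" by (intro Suc.IH) auto
  with Suc.prems show ?case by simp
qed simp

definition table_colourable :: "nat \<Rightarrow> nat \<Rightarrow> bool list \<Rightarrow> bool" where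
  "table_colourable l n bs \<longleftrightarrow> (\<exists>\<phi>. (\<forall>v<n. \<phi> v \<in> {1..l}) \<and>
     (\<forall>u<n. \<forall>v<n. bs ! (u * n + v) \<longrightarrow> \<phi> u \<noteq> (\<phi> v :: nat)))"

text \<open>
  Beyond the threshold the term linear in \<open>n\<close> of the running time is absorbed by the gap between
  \<open>4 n (n - \<delta>) < 12/5 n\<^sup>2\<close> and \<open>3 n\<^sup>2\<close>.
\<close>

definition threshold :: "nat \<Rightarrow> nat" where
  "threshold l = 2 * (19 * l * l + 31 * l + 25)"

definition Hom_prog :: "nat \<Rightarrow> prog" where
  "Hom_prog l = dispatch_prog (main_prog l) (\<lambda>n. table_prog (n * n) (table_colourable l n)) (threshold l) 0"

section \<open>Graphs of large minimum degree\<close>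

lemma out_degree_eq: "out_degree (with_proj G) v = card {w. (v, w) \<in> parcs G}"
proof -
  have "out_arcs (with_proj G) v = Pair v ` {w. (v, w) \<in> parcs G}"
    by (auto simp: out_arcs_def)
  then show ?thesis by (simp add: out_degree_def card_image inj_on_def)
qed

lemma min_degree_le_card:
  assumes "pair_graph G" "v \<in> pverts G"
  shows "min_degree G \<le> card {w. (v, w) \<in> parcs G}"
proof -
  interpret pair_graph G by fact
  show ?thesis
    unfolding min_degree_def out_degree_eq[symmetric] using assms(2) pair_finite_verts by auto
qed

lemma nonadj_card_le:
  assumes "pair_graph G" "v \<in> pverts G"
  shows "card {w \<in> pverts G. (v, w) \<notin> parcs G} + min_degree G \<le> card (pverts G)"
proof -
  interpret pair_graph G by fact
  have sub: "{w. (v, w) \<in> parcs G} \<subseteq> pverts G" using in_arcsD2 by blast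
  have "card (pverts G) =
      card ({w \<in> pverts G. (v, w) \<notin> parcs G} \<union> {w. (v, w) \<in> parcs G})"
    using sub by (intro arg_cong[of _ _ card]) auto
  also have "\<dots> = card {w \<in> pverts G. (v, w) \<notin> parcs G} + card {w. (v, w) \<in> parcs G}"
    using pair_finite_verts sub by (intro card_Un_disjoint) (auto intro: finite_subset)
  finally show ?thesis using min_degree_le_card[OF assms] by simp
qed

text \<open>Multiplying by 3l - 1 > 0 turns the degree condition into (3l - 1)(n - \<delta>) <
  3n.\<close>

lemma dense_graph_of_min_degree:
  assumes G: "pair_graph G" and card: "card (pverts G) = n" and "2 \<le> l" "0 < n"
    and deg: "real (min_degree G) > (3 * real l - 4) / (3 * real l - 1) * real n"
  shows "dense_graph (pverts G) (\<lambda>u v. (u, v) \<in> parcs G) l (n - min_degree G)"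
proof -
  interpret pair_graph G by fact
  let ?\<delta> = "min_degree G"
  have "pverts G \<noteq> {}" using assms(2,4) by auto
  then obtain v where "v \<in> pverts G" by blast
  \<comment> \<open>This makes the truncated subtraction n - \<delta> exact.\<close>
  then have le: "?\<delta> \<le> n" using nonadj_card_le[OF G] card by fastforce
  have "(3 * real l - 4) * real n < real ?\<delta> * (3 * real l - 1)"
    using deg assms(3) by (simp add: divide_less_eq)
  then have "3 * real l * (real n - real ?\<delta>) < 3 * real n + (real n - real ?\<delta>)"
    by (simp add: algebra_simps)
  then have "real (3 * l * (n - ?\<delta>)) < real (3 * n + (n - ?\<delta>))"
    using le by (simp add: of_nat_diff)
  then have "3 * l * (n - ?\<delta>) < 3 * n + (n - ?\<delta>)" by (simp only: of_nat_less_iff)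
  moreover have "card {w \<in> pverts G. (v, w) \<notin> parcs G} \<le> n - ?\<delta>" if "v \<in> pverts G" for v
    using nonadj_card_le[OF G that] card by simp
  ultimately show ?thesis
    using pair_finite_verts card by unfold_locales (auto dest: no_loops' intro: arcs_symmetric)
qed

section \<open>Homomorphisms as colourings, and the final estimates\<close>

lemma hom_to_K_iff:
  assumes "pair_graph G" "dense_graph (pverts G) (\<lambda>u v. (u, v) \<in> parcs G) l d"
  shows "hom_to_K l G \<phi> \<longleftrightarrow> dense_graph.colouring (pverts G) (\<lambda>u v. (u, v) \<in> parcs G) l \<phi>"
proof -
  interpret pair_graph G by fact
  show ?thesis
    unfolding hom_to_K_def dense_graph.colouring_def[OF assms(2)] using in_arcsD1 in_arcsD2 by blast
qed

lemma hom_to_K_unique_of_min_degree: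
  assumes "pair_graph G" "card (pverts G) = n" "2 \<le> l"
    "real (min_degree G) > (3 * real l - 4) / (3 * real l - 1) * real n"
  shows "hom_to_K_unique l G"
proof (cases "n = 0")
  case True
  interpret pair_graph G by fact
  \<comment> \<open>Without vertices \<open>min_degree\<close> is unspecified, but the identity
    permutation serves.\<close>
  have "pverts G = {}" using True assms(2) pair_finite_verts by simp
  then show ?thesis unfolding hom_to_K_unique_def by (auto intro: exI[of _ id] permutes_id)
next
  case False
  then have dense: "dense_graph (pverts G) (\<lambda>u v. (u, v) \<in> parcs G) l (n - min_degree G)"
    using assms by (intro dense_graph_of_min_degree) auto
  show ?thesis
    unfolding hom_to_K_unique_def hom_to_K_iff[OF assms(1) dense]
    using dense_graph.colouring_unique[OF dense] by blast
qed

lemma Hom_prog_solves: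
  assumes "2 \<le> l" "\<alpha> > (3 * real l - 4) / (3 * real l - 1)"
  shows "solves_Hom_K (Hom_prog l) l \<alpha> (\<lambda>n. (l + 1) * n\<^sup>2)"
  unfolding solves_Hom_K_def
proof (intro allI impI)
  fix n :: nat and G
  assume n: "1 \<le> n" and G: "pair_graph G" "pverts G = {..<n}"
    and deg: "\<alpha> * real n \<le> real (min_degree G)"
  interpret pair_graph G by fact
  let ?A = "\<lambda>u v. (u, v) \<in> parcs G" and ?d = "n - min_degree G"
  have "(3 * real l - 4) / (3 * real l - 1) * real n < \<alpha> * real n"
    using assms(2) n by (intro mult_strict_right_mono) auto
  then have dg: "dense_graph {..<n} ?A l ?d"
    using dense_graph_of_min_degree[OF G(1), of n l] G(2) n assms(1) deg by simp
  interpret ram_graph n ?A l ?d using dg by (simp add: ram_graph_def)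
  have hom: "hom_to_K l G \<phi> \<longleftrightarrow> colouring \<phi>" for \<phi>
    by (rule hom_to_K_iff[OF G(1), unfolded G(2), OF dg])
  define r :: "nat \<Rightarrow> nat" where "r = (\<lambda>i. if i = 0 then n else 0)"
  define m :: "nat \<Rightarrow> nat"
    where "m = (\<lambda>k. if k < n\<^sup>2 \<and> (k div n, k mod n) \<in> parcs G then 1 else 0)"
  have m: "m (u * n + v) = (if ?A u v then 1 else 0)" if "u < n" "v < n" for u v
    using that matrix_address[OF that] by (simp add: m_def power2_eq_square)
  let ?Q = "\<lambda>(r, m). r (0::nat) \<noteq> (0::nat) \<longleftrightarrow> (\<exists>\<phi>. hom_to_K l G \<phi>)"
  have le: "3 * n\<^sup>2 \<le> (l + 1) * n\<^sup>2" using assms(1) by (intro mult_le_mono1) simp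
  have "runs (Hom_prog l) (r, m) ((l + 1) * n\<^sup>2) ?Q"
  proof (cases "n < threshold l")
    case True
    \<comment> \<open>A single vertex has degree 0, contrary to \<alpha> > 0. This excludes the only
      n \<ge> 1 for which the lookup time 2n^2 + n + 2 exceeds 3n^2.\<close>
    have "n \<noteq> 1"
    proof
      assume "n = 1"
      then have "parcs G = {}" using G(2) in_arcsD1 in_arcsD2 no_loops' by fastforce
      then have "min_degree G = 0"
        using min_degree_le_card[OF G(1), of 0] G(2) n by simp
      moreover have "0 < \<alpha>"
        using assms by (intro order.strict_trans2[OF _ less_imp_le[OF assms(2)]] divide_pos_pos) auto
      ultimately show False using deg \<open>n = 1\<close> by simp
    qed
    then have "2 * n \<le> n * n" using n by (intro mult_le_mono1) simp
    with le n \<open>n \<noteq> 1\<close> have time: "n - 0 + 1 + (2 * (n * n) + 1) \<le> (l + 1) * n\<^sup>2"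
      unfolding power2_eq_square by linarith
    let ?bs = "map (\<lambda>i. m i = 1) [0..<n * n]"
    have "?bs ! (u * n + v) \<longleftrightarrow> ?A u v" if "u < n" "v < n" for u v
      using m[OF that] matrix_address[OF that] by simp
    then have col: "table_colourable l n ?bs \<longleftrightarrow> (\<exists>\<phi>. hom_to_K l G \<phi>)"
      unfolding hom colouring_def table_colourable_def by auto
    have "runs (table_prog (n * n) (table_colourable l n)) (r, m) (2 * (n * n) + 1) ?Q"
      by (rule runs_mono[OF table_prog_runs order.refl]) (use n col in \<open>auto simp: r_def\<close>)
    then have "runs (Hom_prog l) (r, m) (n - 0 + 1 + (2 * (n * n) + 1)) ?Q"
      unfolding Hom_prog_def using True by (intro dispatch_prog_small) (auto simp: r_def)
    then show ?thesis by (rule runs_mono) (use time in auto)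
  next
    case False
    let ?C = "19 * l * l + 31 * l + 25"
    have "runs (main_prog l) (r, m) (4 * n * ?d + ?C * n) ?Q"
      unfolding r_def hom using n assms(1) m by (intro main_runs) (auto simp: matrix_rep_def)
    then have run: "runs (Hom_prog l) (r, m) (threshold l + (4 * n * ?d + ?C * n)) ?Q"
      unfolding Hom_prog_def using False by (intro dispatch_prog_large[where n = n]) (auto simp: r_def)
    \<comment> \<open>With l \<ge> 2, \<open>dense\<close> gives 5d < 3n, hence 4nd \<le> 12/5
      n^2.\<close>
    have "3 * 2 * ?d \<le> 3 * l * ?d" using assms(1) by (intro mult_le_mono) auto
    with dense_graph.dense[OF dg] have "5 * ?d \<le> 3 * n" unfolding card_lessThan by linarith
    then have "n * (5 * ?d) \<le> n * (3 * n)" by (rule mult_le_mono2)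
    moreover have "n * (2 * ?C) \<le> n * n" "threshold l \<le> n"
      using False by (auto intro!: mult_le_mono2 simp: threshold_def)
    moreover have "25 * n \<le> ?C * n" by (intro mult_le_mono1) simp
    \<comment> \<open>From n \<ge> 2C follows Cn \<le> n^2/2, and C \<ge> 25 bounds the threshold by
      n \<le> n^2/50; with 12/5 n^2 the sum stays below 3n^2.\<close>
    ultimately have "threshold l + (4 * n * ?d + ?C * n) \<le> 3 * n\<^sup>2"
      unfolding power2_eq_square by (simp add: algebra_simps)
    from runs_mono[OF run le_trans[OF this le]] show ?thesis by blast
  qed
  then show "\<exists>t s. exec (Hom_prog l) (input_state n G) t s \<and> t \<le> (l + 1) * n\<^sup>2 \<and>
      (fst s 0 \<noteq> 0 \<longleftrightarrow> (\<exists>\<phi>. hom_to_K l G \<phi>))"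
    unfolding runs_def input_state_def r_def m_def by (auto split: prod.splits)
qed

theorem theorem1p10:
  fixes l :: nat
  assumes "l \<ge> 2"
  shows "(\<forall>\<alpha>::real. \<alpha> > (3 * real l - 4) / (3 * real l - 1) \<longrightarrow>
            Hom_K_solvable_in_time l \<alpha> (\<lambda>n. (l + 1) * n\<^sup>2)) \<and>
         (\<forall>(G :: 'a pair_pre_digraph) n. pair_graph G \<longrightarrow> card (pverts G) = n \<longrightarrow>
            real (min_degree G) > (3 * real l - 4) / (3 * real l - 1) * real n \<longrightarrow>
            hom_to_K_unique l G)"
  using Hom_prog_solves[OF assms] hom_to_K_unique_of_min_degree[OF _ _ assms]
  unfolding Hom_K_solvable_in_time_def by blast

end
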